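(* Let $(M,g)$ be a compact, connected, oriented Riemannian manifold with Riemannian volume form $d\mathrm{vol}_g$, let $X=X_t\in\mathfrak{X}(M)$ be a time-dependent vector field, $V=V_t:M\to\mathbb{R}$ a time-dependent potential, and $\hslash>0$ a constant. Let $\rho$ be a smooth curve in $\mathcal{D}$ that is a solution of the Euler-Lagrange equations associated to the Lagrangian $$\mathcal{L}(\rho,\nabla\phi_t,t):=\int_M\Big(\tfrac12\|\nabla\phi_t\|^2-\tfrac12\|X_t\|^2-V_t\Big)\rho\, d\mathrm{vol}_g-\frac{\hslash^2}{2}\int_M\|\nabla(\sqrt{\rho})\|^2\,d\mathrm{vol}_g ,$$ with $\partial\rho/\partial t=\mathrm{div}(\rho(\nabla\phi+X))$, and let $c_t$ be the function of $t$ such that $$\frac{\partial\phi}{\partial t}=\frac12\|\nabla\phi+X\|^2+V-\frac{\hslash^2}{2}\frac{\Delta(\sqrt{\rho})}{\sqrt{\rho}}+c_t .$$ Then the wave function associated to $\rho$, $$\psi:=\sqrt{\rho}\;e^{-\frac{i}{\hslash}\left(\phi-\int c_t\,dt\right)},$$ satisfies the Schrödinger equation $$i\hslash\frac{\partial\psi}{\partial t}=-\frac{\hslash^2}{2}\Delta\psi-\frac{\hslash}{i}\,g(X,\nabla\psi)+\frac12\Big(-\frac{\hslash}{i}\,\mathrm{div}(X)+\|X\|^2\Big)\psi+V\psi .$$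
   Context: $\mathcal{D}:=\{\rho\in C^\infty(M,\mathbb{R}) : \rho>0,\ \int_M\rho\,d\mathrm{vol}_g=1\}$, a Fréchet submanifold of $C^\infty(M,\mathbb{R})$ with $T_\rho\mathcal{D}\cong\{f\in C^\infty(M,\mathbb{R}):\int_M f\,d\mathrm{vol}_g=0\}$. The divergence is defined by $\mathscr{L}_Z(d\mathrm{vol}_g)=\mathrm{div}(Z)\,d\mathrm{vol}_g$, $\nabla$ applied to a function is the Riemannian gradient (extended complex-linearly, as is $g$, to complex-valued functions), $\Delta u=\mathrm{div}(\nabla u)$. All data are smooth (also in $t$). In the Lagrangian $\mathcal{L}:T\mathcal{D}\times\mathbb{R}\to\mathbb{R}$, $(\rho,\nabla\phi_t,t)$ stands for $(\rho,h,t)\in T\mathcal{D}\times\mathbb{R}$ with $h=\mathrm{div}(\rho(\nabla\phi_t+X_t))\in T_\rho\mathcal{D}$; every $h\in T_\rho\mathcal{D}$ has such a form with $\phi_t$ unique up to an additive constant. The Euler-Lagrange equations express that $\rho$ is stationary for $\int\mathcal{L}(\rho,\dot\rho,t)\,dt$ under fixed end-point variations of curves in $\mathcal{D}$; they are equivalent to the existence of a function $c_t$ of $t$ only satisfying the displayed equation for $\partial\phi/\partial t$, where $\phi=\phi_t(x)$ is a smooth function representing $\dot\rho$ through $\partial\rho/\partial t=\mathrm{div}(\rho(\nabla\phi+X))$. $\int c_t\,dt$ denotes an antiderivative of $c_t$. *)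

theory Defs
  imports "HOL-Analysis.Analysis"
begin

section \<open>Smooth maps between open subsets of normed spaces\<close>

text \<open>For finite-dimensional domains, being of class \<open>C\<^sup>k\<close> on an open set in the sense below
  (all iterated directional derivatives exist and are continuous) is the usual notion.\<close>

primrec Ck_on :: "nat \<Rightarrow> 'a::real_normed_vector set \<Rightarrow> ('a \<Rightarrow> 'b::real_normed_vector) \<Rightarrow> bool" where
  "Ck_on 0 S f \<longleftrightarrow> continuous_on S f"
| "Ck_on (Suc k) S f \<longleftrightarrow> (\<forall>x\<in>S. f differentiable (at x)) \<and>
     (\<forall>v. Ck_on k S (\<lambda>x. frechet_derivative f (at x) v))"

definition smooth_on :: "'a::real_normed_vector set \<Rightarrow> ('a \<Rightarrow> 'b::real_normed_vector) \<Rightarrow> bool" where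
  "smooth_on S f \<longleftrightarrow> (\<forall>k. Ck_on k S f)"


section \<open>Oriented smooth manifolds\<close>

text \<open>The manifold is the type \<open>'a\<close>; its dimension is \<open>CARD('n)\<close>.  A chart is a domain together
  with a coordinate map, of which only the values on the domain matter.\<close>

type_synonym ('a, 'n) chart = "'a set \<times> ('a \<Rightarrow> real ^ 'n)"

abbreviation cdom :: "('a, 'n) chart \<Rightarrow> 'a set" where "cdom c \<equiv> fst c"
abbreviation cmap :: "('a, 'n) chart \<Rightarrow> 'a \<Rightarrow> real ^ 'n" where "cmap c \<equiv> snd c"

definition cinv :: "('a, 'n) chart \<Rightarrow> real ^ 'n \<Rightarrow> 'a" where
  "cinv c = inv_into (cdom c) (cmap c)"

text \<open>The differential, at the point \<open>p\<close>, of the change of coordinates from \<open>c\<close> to \<open>c'\<close>.\<close>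

definition transition_deriv ::
  "('a, 'n::finite) chart \<Rightarrow> ('a, 'n) chart \<Rightarrow> 'a \<Rightarrow> real ^ 'n \<Rightarrow> real ^ 'n" where
  "transition_deriv c c' p = frechet_derivative (cmap c' \<circ> cinv c) (at (cmap c p))"

definition smooth_atlas :: "('a::topological_space, 'n::finite) chart set \<Rightarrow> bool" where
  "smooth_atlas A \<longleftrightarrow>
     (\<Union>c\<in>A. cdom c) = UNIV \<and>
     (\<forall>c\<in>A. open (cdom c) \<and> open (cmap c ` cdom c) \<and>
        homeomorphism (cdom c) (cmap c ` cdom c) (cmap c) (cinv c)) \<and>
     (\<forall>c\<in>A. \<forall>c'\<in>A. smooth_on (cmap c ` (cdom c \<inter> cdom c')) (cmap c' \<circ> cinv c))"

text \<open>An orientation is encoded by an atlas all of whose charts are positively oriented.\<close>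

definition oriented_atlas :: "('a::topological_space, 'n::finite) chart set \<Rightarrow> bool" where
  "oriented_atlas A \<longleftrightarrow> smooth_atlas A \<and>
     (\<forall>c\<in>A. \<forall>c'\<in>A. \<forall>p \<in> cdom c \<inter> cdom c'. det (matrix (transition_deriv c c' p)) > 0)"

text \<open>A chart around \<open>p\<close>.  It is only used to evaluate expressions that do not depend on the
  chart.\<close>

definition chart_at :: "('a, 'n) chart set \<Rightarrow> 'a \<Rightarrow> ('a, 'n) chart" where
  "chart_at A p = (SOME c. c \<in> A \<and> p \<in> cdom c)"

definition smooth_fun ::
  "('a, 'n::finite) chart set \<Rightarrow> ('a \<Rightarrow> 'b::real_normed_vector) \<Rightarrow> bool" where
  "smooth_fun A f \<longleftrightarrow> (\<forall>c\<in>A. smooth_on (cmap c ` cdom c) (f \<circ> cinv c))"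

text \<open>Families of functions that depend on a parameter in the open set \<open>S\<close>, jointly smooth in the
  parameter and the point.\<close>

definition smooth_fun_family ::
  "('a, 'n::finite) chart set \<Rightarrow> 'p::real_normed_vector set \<Rightarrow>
    ('p \<Rightarrow> 'a \<Rightarrow> 'b::real_normed_vector) \<Rightarrow> bool" where
  "smooth_fun_family A S f \<longleftrightarrow>
     (\<forall>c\<in>A. smooth_on (S \<times> cmap c ` cdom c) (\<lambda>(s, y). f s (cinv c y)))"


section \<open>Tangent vectors and vector fields\<close>

text \<open>A tangent vector at \<open>p\<close> is the family of its components in all charts around \<open>p\<close>, which
  transform by the differentials of the changes of coordinates; it is \<open>0\<close> on all other charts, so
  that equality of tangent vectors is equality of functions.\<close>

type_synonym ('a, 'n) tvec = "('a, 'n) chart \<Rightarrow> real ^ 'n"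

definition tangent_space :: "('a, 'n::finite) chart set \<Rightarrow> 'a \<Rightarrow> ('a, 'n) tvec set" where
  "tangent_space A p = {v.
     (\<forall>c\<in>A. \<forall>c'\<in>A. p \<in> cdom c \<inter> cdom c' \<longrightarrow> v c' = transition_deriv c c' p (v c)) \<and>
     (\<forall>c. \<not> (c \<in> A \<and> p \<in> cdom c) \<longrightarrow> v c = 0)}"

definition tvec_add :: "('a, 'n::finite) tvec \<Rightarrow> ('a, 'n) tvec \<Rightarrow> ('a, 'n) tvec" where
  "tvec_add v w = (\<lambda>c. v c + w c)"

definition tvec_scale :: "real \<Rightarrow> ('a, 'n::finite) tvec \<Rightarrow> ('a, 'n) tvec" where
  "tvec_scale r v = (\<lambda>c. r *\<^sub>R v c)"

text \<open>The tangent vector at \<open>p\<close> whose components in the chart \<open>c\<close> around \<open>p\<close> are \<open>w\<close>.\<close>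

definition tvec_of ::
  "('a, 'n::finite) chart set \<Rightarrow> ('a, 'n) chart \<Rightarrow> 'a \<Rightarrow> real ^ 'n \<Rightarrow> ('a, 'n) tvec" where
  "tvec_of A c p w =
     (\<lambda>c'. if c' \<in> A \<and> p \<in> cdom c' then transition_deriv c c' p w else 0)"

definition coord_field ::
  "('a, 'n::finite) chart set \<Rightarrow> ('a, 'n) chart \<Rightarrow> 'n \<Rightarrow> 'a \<Rightarrow> ('a, 'n) tvec" where
  "coord_field A c i p = tvec_of A c p (axis i 1)"

definition smooth_vector_field_on ::
  "('a, 'n::finite) chart set \<Rightarrow> 'a set \<Rightarrow> ('a \<Rightarrow> ('a, 'n) tvec) \<Rightarrow> bool" where
  "smooth_vector_field_on A U Y \<longleftrightarrow>
     (\<forall>q\<in>U. Y q \<in> tangent_space A q) \<and>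
     (\<forall>c\<in>A. smooth_on (cmap c ` (cdom c \<inter> U)) (\<lambda>y. Y (cinv c y) c))"

definition smooth_vector_field_family ::
  "('a, 'n::finite) chart set \<Rightarrow> 'p::real_normed_vector set \<Rightarrow>
    ('p \<Rightarrow> 'a \<Rightarrow> ('a, 'n) tvec) \<Rightarrow> bool" where
  "smooth_vector_field_family A S X \<longleftrightarrow>
     (\<forall>s\<in>S. \<forall>p. X s p \<in> tangent_space A p) \<and>
     (\<forall>c\<in>A. smooth_on (S \<times> cmap c ` cdom c) (\<lambda>(s, y). X s (cinv c y) c))"

text \<open>The differential \<open>df\<^sub>p(v)\<close> of a function, that is, the derivative of \<open>f\<close> along \<open>v\<close>.\<close>

definition differential ::
  "('a, 'n::finite) chart set \<Rightarrow> ('a \<Rightarrow> real) \<Rightarrow> 'a \<Rightarrow> ('a, 'n) tvec \<Rightarrow> real" where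
  "differential A f p v =
     (let c = chart_at A p in frechet_derivative (f \<circ> cinv c) (at (cmap c p)) (v c))"

text \<open>\<open>[Y, Z]\<^sup>i = Y\<^sup>j \<partial>\<^sub>j Z\<^sup>i - Z\<^sup>j \<partial>\<^sub>j Y\<^sup>i\<close> in every chart.\<close>

definition lie_bracket ::
  "('a, 'n::finite) chart set \<Rightarrow> ('a \<Rightarrow> ('a, 'n) tvec) \<Rightarrow> ('a \<Rightarrow> ('a, 'n) tvec) \<Rightarrow>
    'a \<Rightarrow> ('a, 'n) tvec" where
  "lie_bracket A Y Z p = (\<lambda>c. if c \<in> A \<and> p \<in> cdom c
     then frechet_derivative (\<lambda>y. Z (cinv c y) c) (at (cmap c p)) (Y p c)
        - frechet_derivative (\<lambda>y. Y (cinv c y) c) (at (cmap c p)) (Z p c)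
     else 0)"

text \<open>The Lie derivative of a differential form \<open>\<omega>\<close> of degree \<open>CARD('n)\<close>, evaluated on vector
  fields \<open>Y i\<close>:
  \<open>(L\<^sub>Z \<omega>)(Y\<^sub>1, \<dots>, Y\<^sub>n) = Z(\<omega>(Y\<^sub>1, \<dots>, Y\<^sub>n)) - \<Sum>\<^sub>i \<omega>(Y\<^sub>1, \<dots>, [Z, Y\<^sub>i], \<dots>, Y\<^sub>n)\<close>.\<close>

definition lie_derivative ::
  "('a, 'n::finite) chart set \<Rightarrow> ('a \<Rightarrow> ('a, 'n) tvec) \<Rightarrow>
    ('a \<Rightarrow> ('n \<Rightarrow> ('a, 'n) tvec) \<Rightarrow> real) \<Rightarrow> ('n \<Rightarrow> 'a \<Rightarrow> ('a, 'n) tvec) \<Rightarrow> 'a \<Rightarrow> real" where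
  "lie_derivative A Z \<omega> Y p =
     differential A (\<lambda>q. \<omega> q (\<lambda>i. Y i q)) p (Z p)
     - (\<Sum>i\<in>UNIV. \<omega> p ((\<lambda>j. Y j p)(i := lie_bracket A Z (Y i) p)))"


section \<open>Riemannian geometry\<close>

text \<open>The matrix \<open>g\<^sub>i\<^sub>j\<close> of the metric in the chart \<open>c\<close>.\<close>

definition gram ::
  "('a, 'n::finite) chart set \<Rightarrow> ('a \<Rightarrow> ('a, 'n) tvec \<Rightarrow> ('a, 'n) tvec \<Rightarrow> real) \<Rightarrow>
    ('a, 'n) chart \<Rightarrow> 'a \<Rightarrow> real ^ 'n ^ 'n" where
  "gram A g c p = (\<chi> i j. g p (coord_field A c i p) (coord_field A c j p))"

definition riemannian_metric ::
  "('a, 'n::finite) chart set \<Rightarrow> ('a \<Rightarrow> ('a, 'n) tvec \<Rightarrow> ('a, 'n) tvec \<Rightarrow> real) \<Rightarrow> bool" where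
  "riemannian_metric A g \<longleftrightarrow>
     (\<forall>p. \<forall>u\<in>tangent_space A p. \<forall>v\<in>tangent_space A p. \<forall>w\<in>tangent_space A p. \<forall>r.
        g p (tvec_add u v) w = g p u w + g p v w \<and>
        g p (tvec_scale r u) w = r * g p u w \<and>
        g p u w = g p w u \<and>
        (u \<noteq> (\<lambda>c. 0) \<longrightarrow> g p u u > 0)) \<and>
     (\<forall>c\<in>A. \<forall>i j. smooth_on (cmap c ` cdom c) (\<lambda>y. gram A g c (cinv c y) $ i $ j))"

definition compact_connected_oriented_riemannian_manifold ::
  "('a::t2_space, 'n::finite) chart set \<Rightarrow>
    ('a \<Rightarrow> ('a, 'n) tvec \<Rightarrow> ('a, 'n) tvec \<Rightarrow> real) \<Rightarrow> bool" where
  "compact_connected_oriented_riemannian_manifold A g \<longleftrightarrow>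
     compact (UNIV :: 'a set) \<and> connected (UNIV :: 'a set) \<and>
     oriented_atlas A \<and> riemannian_metric A g"

definition grad ::
  "('a, 'n::finite) chart set \<Rightarrow> ('a \<Rightarrow> ('a, 'n) tvec \<Rightarrow> ('a, 'n) tvec \<Rightarrow> real) \<Rightarrow>
    ('a \<Rightarrow> real) \<Rightarrow> 'a \<Rightarrow> ('a, 'n) tvec" where
  "grad A g f p = (THE v. v \<in> tangent_space A p \<and>
     (\<forall>w\<in>tangent_space A p. g p v w = differential A f p w))"

text \<open>The Riemannian volume form, \<open>\<surd>(det g\<^sub>i\<^sub>j) dx\<^sup>1 \<and> \<dots> \<and> dx\<^sup>n\<close> in every (positively oriented)
  chart.\<close>

definition vol_form ::
  "('a, 'n::finite) chart set \<Rightarrow> ('a \<Rightarrow> ('a, 'n) tvec \<Rightarrow> ('a, 'n) tvec \<Rightarrow> real) \<Rightarrow>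
    'a \<Rightarrow> ('n \<Rightarrow> ('a, 'n) tvec) \<Rightarrow> real" where
  "vol_form A g p v =
     (let c = chart_at A p in sqrt (det (gram A g c p)) * det (\<chi> i. v i c))"

text \<open>\<open>L\<^sub>Z(dvol) = div(Z) dvol\<close>.  The test fields \<open>Y i\<close> are allowed to be defined only near \<open>p\<close>.\<close>

definition divergence ::
  "('a::topological_space, 'n::finite) chart set \<Rightarrow>
    ('a \<Rightarrow> ('a, 'n) tvec \<Rightarrow> ('a, 'n) tvec \<Rightarrow> real) \<Rightarrow> ('a \<Rightarrow> ('a, 'n) tvec) \<Rightarrow> 'a \<Rightarrow> real" where
  "divergence A g Z p = (THE d. \<forall>U Y. open U \<and> p \<in> U \<and>
     (\<forall>i. smooth_vector_field_on A U (Y i)) \<longrightarrow>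
     lie_derivative A Z (vol_form A g) Y p = d * vol_form A g p (\<lambda>i. Y i p))"

definition laplacian ::
  "('a::topological_space, 'n::finite) chart set \<Rightarrow>
    ('a \<Rightarrow> ('a, 'n) tvec \<Rightarrow> ('a, 'n) tvec \<Rightarrow> real) \<Rightarrow> ('a \<Rightarrow> real) \<Rightarrow> 'a \<Rightarrow> real" where
  "laplacian A g f = divergence A g (grad A g f)"

text \<open>Integration of functions against the volume form of the oriented manifold is integration with
  respect to the Borel measure which has density \<open>\<surd>(det g\<^sub>i\<^sub>j)\<close> in every chart.\<close>

definition vol_measure ::
  "('a::topological_space, 'n::finite) chart set \<Rightarrow>
    ('a \<Rightarrow> ('a, 'n) tvec \<Rightarrow> ('a, 'n) tvec \<Rightarrow> real) \<Rightarrow> 'a measure" where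
  "vol_measure A g = (THE \<mu>. sets \<mu> = sets borel \<and>
     (\<forall>c\<in>A. \<forall>B\<in>sets borel. B \<subseteq> cdom c \<longrightarrow>
        emeasure \<mu> B =
          (\<integral>\<^sup>+y\<in>cmap c ` B. ennreal (sqrt (det (gram A g c (cinv c y)))) \<partial>lborel)))"


section \<open>Complex-linear extensions\<close>

text \<open>A complex tangent vector \<open>v + \<i> w\<close> is the pair \<open>(v, w)\<close>.\<close>

definition cgrad ::
  "('a, 'n::finite) chart set \<Rightarrow> ('a \<Rightarrow> ('a, 'n) tvec \<Rightarrow> ('a, 'n) tvec \<Rightarrow> real) \<Rightarrow>
    ('a \<Rightarrow> complex) \<Rightarrow> 'a \<Rightarrow> ('a, 'n) tvec \<times> ('a, 'n) tvec" where
  "cgrad A g f p = (grad A g (\<lambda>x. Re (f x)) p, grad A g (\<lambda>x. Im (f x)) p)"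

definition cmetric ::
  "('a \<Rightarrow> ('a, 'n) tvec \<Rightarrow> ('a, 'n) tvec \<Rightarrow> real) \<Rightarrow>
    'a \<Rightarrow> ('a, 'n) tvec \<Rightarrow> ('a, 'n) tvec \<times> ('a, 'n) tvec \<Rightarrow> complex" where
  "cmetric g p v w = Complex (g p v (fst w)) (g p v (snd w))"

definition cdivergence ::
  "('a::topological_space, 'n::finite) chart set \<Rightarrow>
    ('a \<Rightarrow> ('a, 'n) tvec \<Rightarrow> ('a, 'n) tvec \<Rightarrow> real) \<Rightarrow>
    ('a \<Rightarrow> ('a, 'n) tvec \<times> ('a, 'n) tvec) \<Rightarrow> 'a \<Rightarrow> complex" where
  "cdivergence A g Z p =
     Complex (divergence A g (\<lambda>x. fst (Z x)) p) (divergence A g (\<lambda>x. snd (Z x)) p)"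

definition claplacian ::
  "('a::topological_space, 'n::finite) chart set \<Rightarrow>
    ('a \<Rightarrow> ('a, 'n) tvec \<Rightarrow> ('a, 'n) tvec \<Rightarrow> real) \<Rightarrow> ('a \<Rightarrow> complex) \<Rightarrow> 'a \<Rightarrow> complex" where
  "claplacian A g f = cdivergence A g (cgrad A g f)"


section \<open>Densities, the Lagrangian and its Euler-Lagrange equations\<close>

definition densities ::
  "('a::topological_space, 'n::finite) chart set \<Rightarrow>
    ('a \<Rightarrow> ('a, 'n) tvec \<Rightarrow> ('a, 'n) tvec \<Rightarrow> real) \<Rightarrow> ('a \<Rightarrow> real) set" where
  "densities A g = {\<rho>. smooth_fun A \<rho> \<and> (\<forall>x. \<rho> x > 0) \<and> (\<integral>x. \<rho> x \<partial>vol_measure A g) = 1}"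

definition time_deriv :: "(real \<Rightarrow> 'a \<Rightarrow> 'b::real_normed_vector) \<Rightarrow> real \<Rightarrow> 'a \<Rightarrow> 'b" where
  "time_deriv f t x = vector_derivative (\<lambda>s. f s x) (at t)"

text \<open>\<open>div(\<rho> (\<nabla>\<phi> + X))\<close>.\<close>

definition velocity ::
  "('a::topological_space, 'n::finite) chart set \<Rightarrow>
    ('a \<Rightarrow> ('a, 'n) tvec \<Rightarrow> ('a, 'n) tvec \<Rightarrow> real) \<Rightarrow> ('a \<Rightarrow> ('a, 'n) tvec) \<Rightarrow>
    ('a \<Rightarrow> real) \<Rightarrow> ('a \<Rightarrow> real) \<Rightarrow> 'a \<Rightarrow> real" where
  "velocity A g X \<rho> \<phi> =
     divergence A g (\<lambda>x. tvec_scale (\<rho> x) (tvec_add (grad A g \<phi> x) (X x)))"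

definition lagrangian_integrals ::
  "('a::topological_space, 'n::finite) chart set \<Rightarrow>
    ('a \<Rightarrow> ('a, 'n) tvec \<Rightarrow> ('a, 'n) tvec \<Rightarrow> real) \<Rightarrow> (real \<Rightarrow> 'a \<Rightarrow> ('a, 'n) tvec) \<Rightarrow>
    (real \<Rightarrow> 'a \<Rightarrow> real) \<Rightarrow> real \<Rightarrow> ('a \<Rightarrow> real) \<Rightarrow> ('a \<Rightarrow> real) \<Rightarrow> real \<Rightarrow> real" where
  "lagrangian_integrals A g X V hbar \<rho> \<phi> t =
     (\<integral>x. (1/2 * g x (grad A g \<phi> x) (grad A g \<phi> x) - 1/2 * g x (X t x) (X t x) - V t x) * \<rho> x
        \<partial>vol_measure A g)
     - hbar\<^sup>2 / 2 *
       (\<integral>x. g x (grad A g (\<lambda>y. sqrt (\<rho> y)) x) (grad A g (\<lambda>y. sqrt (\<rho> y)) x)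
          \<partial>vol_measure A g)"

text \<open>The Lagrangian at \<open>(\<rho>, h, t)\<close>, where \<open>h\<close> is tangent to the densities at \<open>\<rho>\<close>.\<close>

definition lagrangian ::
  "('a::topological_space, 'n::finite) chart set \<Rightarrow>
    ('a \<Rightarrow> ('a, 'n) tvec \<Rightarrow> ('a, 'n) tvec \<Rightarrow> real) \<Rightarrow> (real \<Rightarrow> 'a \<Rightarrow> ('a, 'n) tvec) \<Rightarrow>
    (real \<Rightarrow> 'a \<Rightarrow> real) \<Rightarrow> real \<Rightarrow> ('a \<Rightarrow> real) \<Rightarrow> ('a \<Rightarrow> real) \<Rightarrow> real \<Rightarrow> real" where
  "lagrangian A g X V hbar \<rho> h t = (THE l. \<exists>\<phi>. smooth_fun A \<phi> \<and> h = velocity A g (X t) \<rho> \<phi> \<and>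
     l = lagrangian_integrals A g X V hbar \<rho> \<phi> t)"

definition smooth_density_curve ::
  "('a::topological_space, 'n::finite) chart set \<Rightarrow>
    ('a \<Rightarrow> ('a, 'n) tvec \<Rightarrow> ('a, 'n) tvec \<Rightarrow> real) \<Rightarrow> real set \<Rightarrow> (real \<Rightarrow> 'a \<Rightarrow> real) \<Rightarrow> bool" where
  "smooth_density_curve A g I \<rho> \<longleftrightarrow>
     smooth_fun_family A I \<rho> \<and> (\<forall>t\<in>I. \<rho> t \<in> densities A g)"

text \<open>Stationarity of the action over every compact subinterval of \<open>I\<close>, under all smooth variations
  \<open>\<sigma> s\<close> of \<open>\<rho>\<close> through curves of densities with the end points fixed.\<close>

definition euler_lagrange ::
  "('a::topological_space, 'n::finite) chart set \<Rightarrow>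
    ('a \<Rightarrow> ('a, 'n) tvec \<Rightarrow> ('a, 'n) tvec \<Rightarrow> real) \<Rightarrow> (real \<Rightarrow> 'a \<Rightarrow> ('a, 'n) tvec) \<Rightarrow>
    (real \<Rightarrow> 'a \<Rightarrow> real) \<Rightarrow> real \<Rightarrow> real set \<Rightarrow> (real \<Rightarrow> 'a \<Rightarrow> real) \<Rightarrow> bool" where
  "euler_lagrange A g X V hbar I \<rho> \<longleftrightarrow>
     (\<forall>a b \<epsilon>. \<forall>\<sigma> :: real \<Rightarrow> real \<Rightarrow> 'a \<Rightarrow> real.
        a < b \<and> {a..b} \<subseteq> I \<and> \<epsilon> > 0 \<and>
        smooth_fun_family A ({-\<epsilon><..<\<epsilon>} \<times> I) (\<lambda>(s, t). \<sigma> s t) \<and>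
        (\<forall>s\<in>{-\<epsilon><..<\<epsilon>}. \<forall>t\<in>I. \<sigma> s t \<in> densities A g) \<and>
        (\<forall>t\<in>I. \<sigma> 0 t = \<rho> t) \<and>
        (\<forall>s\<in>{-\<epsilon><..<\<epsilon>}. \<sigma> s a = \<rho> a \<and> \<sigma> s b = \<rho> b) \<longrightarrow>
        ((\<lambda>s. integral {a..b}
                (\<lambda>t. lagrangian A g X V hbar (\<sigma> s t) (time_deriv (\<sigma> s) t) t))
           has_real_derivative 0) (at 0))"

text \<open>\<open>C\<close> stands for \<open>\<integral>c\<^sub>t dt\<close>.\<close>

definition wave_function ::
  "real \<Rightarrow> (real \<Rightarrow> 'a \<Rightarrow> real) \<Rightarrow> (real \<Rightarrow> 'a \<Rightarrow> real) \<Rightarrow> (real \<Rightarrow> real) \<Rightarrow>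
    real \<Rightarrow> 'a \<Rightarrow> complex" where
  "wave_function hbar \<rho> \<phi> C t x =
     complex_of_real (sqrt (\<rho> t x)) *
       exp (- (\<i> / complex_of_real hbar) * complex_of_real (\<phi> t x - C t))"

end

theory Submission
  imports Defs
begin

text \<open>This is the Madelung transformation.  Write \<open>\<psi> = R e\<^sup>-\<^sup>i\<^sup>\<theta>\<close> with \<open>R = \<surd>\<rho>\<close> and
  \<open>\<theta> = (\<phi> - C) / \<hbar>\<close>.  Every term of the Schroedinger equation is \<open>e\<^sup>-\<^sup>i\<^sup>\<theta>\<close> times a complex number
  built from \<open>R\<close>, \<open>\<theta>\<close>, \<open>X\<close> and \<open>V\<close>, since
  \<open>\<partial>\<^sub>t\<psi> = e\<^sup>-\<^sup>i\<^sup>\<theta> (\<partial>\<^sub>tR - i R \<partial>\<^sub>t\<theta>)\<close>,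
  \<open>g(X, \<nabla>\<psi>) = e\<^sup>-\<^sup>i\<^sup>\<theta> (g(X, \<nabla>R) - i R g(X, \<nabla>\<theta>))\<close> and
  \<open>\<Delta>\<psi> = e\<^sup>-\<^sup>i\<^sup>\<theta> (\<Delta>R - R |\<nabla>\<theta>|\<^sup>2 - i (2 g(\<nabla>R, \<nabla>\<theta>) + R \<Delta>\<theta>))\<close>
  (\<open>has_vector_derivative_polar\<close>, \<open>cgrad_polar\<close>, \<open>claplacian_polar\<close>).  After division by
  \<open>e\<^sup>-\<^sup>i\<^sup>\<theta>\<close> the real part of the equation is \<open>R\<close> times the equation for \<open>\<partial>\<^sub>t\<phi>\<close>, in which \<open>c\<close> is
  cancelled by the derivative of \<open>C\<close>, and the imaginary part is \<open>\<hbar> / (2 R)\<close> times the continuity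
  equation \<open>\<partial>\<^sub>t\<rho> = div(\<rho> (\<nabla>\<phi> + X))\<close> (\<open>velocity_square\<close>).

  What this computation needs from geometry is the algebra of \<open>\<nabla>\<close>, \<open>div\<close> and \<open>\<Delta>\<close>: the product and
  chain rules \<open>grad_mult\<close>, \<open>grad_compose\<close>, \<open>laplacian_mult\<close> and \<open>laplacian_compose\<close>, which follow
  from \<open>div(Z + W) = div Z + div W\<close> and \<open>div(f Z) = f div Z + df(Z)\<close>.  Both \<open>grad\<close> and
  \<open>divergence\<close> are definite descriptions, so existence and uniqueness have to be proved.  For the
  gradient they express that the matrix \<open>g\<^sub>i\<^sub>j\<close> is invertible (\<open>grad_works\<close>).  For the divergence, the
  Lie derivative of the volume form is computed in a chart (\<open>lie_derivative_vol_form\<close>), which gives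
  \<open>div Z = tr(DZ) + ds(Z) / s\<close> with \<open>s = \<surd>(det g\<^sub>i\<^sub>j)\<close> (\<open>divergence_in_chart\<close>); the coordinate fields
  are test fields on which the volume form does not vanish, so that no other number satisfies the
  defining condition.\<close>

section \<open>Calculus of iterated directional derivatives\<close>

lemma frechet_derivative_eqI:
  "(f has_derivative f') (at x) \<Longrightarrow> frechet_derivative f (at x) = f'"
  using frechet_derivative_at by metis

lemma Ck_on_cong:
  assumes "open S" "\<And>x. x \<in> S \<Longrightarrow> f x = g x" "Ck_on k S f"
  shows "Ck_on k S g"
  using assms(2,3)
proof (induction k arbitrary: f g)
  case 0
  then show ?case by (simp cong: continuous_on_cong)
next
  case (Suc k)
  have der: "(g has_derivative frechet_derivative f (at x)) (at x)" if "x \<in> S" for x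
  proof (rule has_derivative_transform_within_open[OF _ assms(1) that])
    show "(f has_derivative frechet_derivative f (at x)) (at x)"
      using Suc.prems that by (simp add: frechet_derivative_works)
  qed (use Suc.prems in auto)
  have "Ck_on k S (\<lambda>x. frechet_derivative g (at x) v)" for v
  proof (rule Suc.IH)
    show "Ck_on k S (\<lambda>x. frechet_derivative f (at x) v)"
      using Suc.prems by simp
  qed (simp add: frechet_derivative_eqI[OF der])
  then show ?case using der by (auto simp: differentiable_def)
qed

lemma Ck_on_Suc_imp: "Ck_on (Suc k) S f \<Longrightarrow> Ck_on k S f"
proof (induction k arbitrary: f)
  case 0
  then show ?case
    by (auto intro!: continuous_at_imp_continuous_on differentiable_imp_continuous_within)
next
  case (Suc k)
  from Suc.prems have "\<forall>x\<in>S. f differentiable (at x)"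
    and "\<And>v. Ck_on (Suc k) S (\<lambda>x. frechet_derivative f (at x) v)" by auto
  then show ?case using Suc.IH by (simp only: Ck_on.simps) blast
qed

lemma Ck_on_zero: "Ck_on k S (\<lambda>x. 0)"
proof (induction k)
  case (Suc k)
  then show ?case by (simp only: Ck_on.simps frechet_derivative_const differentiable_const) simp
qed simp

lemma Ck_on_add:
  assumes "open S" "Ck_on k S f" "Ck_on k S g"
  shows "Ck_on k S (\<lambda>x. f x + g x)"
  using assms(2,3)
proof (induction k arbitrary: f g)
  case 0
  then show ?case by (auto intro: continuous_intros)
next
  case (Suc k)
  have der: "((\<lambda>x. f x + g x) has_derivative
      (\<lambda>v. frechet_derivative f (at x) v + frechet_derivative g (at x) v)) (at x)" if "x \<in> S" for x
    using Suc.prems that by (intro has_derivative_add) (simp_all add: frechet_derivative_works)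
  have "Ck_on k S (\<lambda>x. frechet_derivative (\<lambda>x. f x + g x) (at x) v)" for v
  proof (rule Ck_on_cong[OF assms(1)])
    show "Ck_on k S (\<lambda>x. frechet_derivative f (at x) v + frechet_derivative g (at x) v)"
      using Suc.prems by (intro Suc.IH) auto
  qed (simp add: frechet_derivative_eqI[OF der])
  then show ?case using der by (auto simp: differentiable_def)
qed

lemma Ck_on_sum:
  assumes "open S" "finite J" "\<And>j. j \<in> J \<Longrightarrow> Ck_on k S (f j)"
  shows "Ck_on k S (\<lambda>x. \<Sum>j\<in>J. f j x)"
  using assms(2,3)
  by (induction J rule: finite_induct) (auto intro!: Ck_on_zero Ck_on_add[OF assms(1)])

lemma Ck_on_scaleR:
  assumes "open S" "Ck_on k S f" "Ck_on k S g"
  shows "Ck_on k S (\<lambda>x. f x *\<^sub>R g x)"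
  using assms(2,3)
proof (induction k arbitrary: f g)
  case 0
  then show ?case by (auto intro: continuous_intros)
next
  case (Suc k)
  have der: "((\<lambda>x. f x *\<^sub>R g x) has_derivative
      (\<lambda>v. f x *\<^sub>R frechet_derivative g (at x) v + frechet_derivative f (at x) v *\<^sub>R g x)) (at x)"
    if "x \<in> S" for x
    using Suc.prems that by (intro has_derivative_scaleR) (simp_all add: frechet_derivative_works)
  have "Ck_on k S (\<lambda>x. frechet_derivative (\<lambda>x. f x *\<^sub>R g x) (at x) v)" for v
  proof (rule Ck_on_cong[OF assms(1)])
    show "Ck_on k S (\<lambda>x. f x *\<^sub>R frechet_derivative g (at x) v + frechet_derivative f (at x) v *\<^sub>R g x)"
      using Suc.prems Suc.prems[THEN Ck_on_Suc_imp]
      by (intro Ck_on_add[OF assms(1)] Suc.IH) auto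
  qed (simp add: frechet_derivative_eqI[OF der])
  then show ?case using der by (auto simp: differentiable_def)
qed

lemma Ck_on_inner:
  assumes "open S" "Ck_on k S f"
  shows "Ck_on k S (\<lambda>x. f x \<bullet> b)"
  using assms(2)
proof (induction k arbitrary: f)
  case 0
  then show ?case by (simp add: continuous_on_inner)
next
  case (Suc k)
  have der: "((\<lambda>x. f x \<bullet> b) has_derivative (\<lambda>v. frechet_derivative f (at x) v \<bullet> b)) (at x)"
    if "x \<in> S" for x
    using Suc.prems that
    by (intro bounded_linear.has_derivative[OF bounded_linear_inner_left])
      (simp add: frechet_derivative_works)
  have "Ck_on k S (\<lambda>x. frechet_derivative (\<lambda>x. f x \<bullet> b) (at x) v)" for v
  proof (rule Ck_on_cong[OF assms(1)])
    show "Ck_on k S (\<lambda>x. frechet_derivative f (at x) v \<bullet> b)"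
      using Suc.prems by (intro Suc.IH) auto
  qed (simp add: frechet_derivative_eqI[OF der])
  then show ?case using der by (auto simp: differentiable_def)
qed

text \<open>The chain rule, with the inner derivative expanded in an orthonormal basis, expresses the
  directional derivatives of a composition by products of functions with one derivative less.\<close>

lemma Ck_on_compose:
  fixes f :: "'b::euclidean_space \<Rightarrow> 'c::real_normed_vector"
  assumes "open S" "open T" "g ` S \<subseteq> T" "Ck_on k T f" "Ck_on k S g"
  shows "Ck_on k S (f \<circ> g)"
  using assms(4,5)
proof (induction k arbitrary: f)
  case 0
  then have "continuous_on S g" "continuous_on (g ` S) f"
    using assms(3) by (auto intro: continuous_on_subset)
  then show ?case unfolding Ck_on.simps(1) by (rule continuous_on_compose)
next
  case (Suc k)
  have der: "((f \<circ> g) has_derivative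
      (\<lambda>v. \<Sum>b\<in>Basis. (frechet_derivative g (at x) v \<bullet> b) *\<^sub>R frechet_derivative f (at (g x)) b))
      (at x)" if "x \<in> S" for x
  proof -
    have f: "(f has_derivative frechet_derivative f (at (g x))) (at (g x))"
      using Suc.prems that assms(3) by (auto simp: frechet_derivative_works)
    then interpret lf: bounded_linear "frechet_derivative f (at (g x))"
      by (rule has_derivative_bounded_linear)
    have "(g has_derivative frechet_derivative g (at x)) (at x)"
      using Suc.prems that by (simp add: frechet_derivative_works)
    from diff_chain_at[OF this f] have "((f \<circ> g) has_derivative
        frechet_derivative f (at (g x)) \<circ> frechet_derivative g (at x)) (at x)" .
    also have "frechet_derivative f (at (g x)) \<circ> frechet_derivative g (at x) =
        (\<lambda>v. \<Sum>b\<in>Basis. (frechet_derivative g (at x) v \<bullet> b) *\<^sub>R frechet_derivative f (at (g x)) b)"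
    proof
      fix v
      let ?w = "frechet_derivative g (at x) v"
      have "frechet_derivative f (at (g x)) ?w =
          frechet_derivative f (at (g x)) (\<Sum>b\<in>Basis. (?w \<bullet> b) *\<^sub>R b)"
        by (simp only: euclidean_representation)
      also have "\<dots> = (\<Sum>b\<in>Basis. (?w \<bullet> b) *\<^sub>R frechet_derivative f (at (g x)) b)"
        by (simp only: lf.sum lf.scaleR)
      finally show "(frechet_derivative f (at (g x)) \<circ> frechet_derivative g (at x)) v = \<dots>"
        by simp
    qed
    finally show ?thesis .
  qed
  have "Ck_on k S (\<lambda>x. frechet_derivative (f \<circ> g) (at x) v)" for v
  proof (rule Ck_on_cong[OF assms(1)])
    have "Ck_on k S ((\<lambda>z. frechet_derivative f (at z) b) \<circ> g)" for b
      using Suc.prems(1) Ck_on_Suc_imp[OF Suc.prems(2)] by (intro Suc.IH) auto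
    then show "Ck_on k S (\<lambda>x. \<Sum>b\<in>Basis. (frechet_derivative g (at x) v \<bullet> b) *\<^sub>R
        frechet_derivative f (at (g x)) b)"
      using Suc.prems(2) unfolding comp_def
      by (intro Ck_on_sum Ck_on_scaleR Ck_on_inner assms(1)) auto
  qed (simp add: frechet_derivative_eqI[OF der])
  then show ?case unfolding Ck_on.simps differentiable_def using der by blast
qed

lemma smooth_on_differentiable:
  assumes "smooth_on S f" "x \<in> S"
  shows "f differentiable (at x)"
proof -
  from assms(1) have "Ck_on (Suc 0) S f" unfolding smooth_on_def by blast
  then show ?thesis using assms(2) by simp
qed

lemma smooth_on_derivative:
  assumes "smooth_on S f"
  shows "smooth_on S (\<lambda>x. frechet_derivative f (at x) v)"
proof -
  have "Ck_on (Suc k) S f" for k using assms unfolding smooth_on_def by blast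
  then show ?thesis by (simp add: smooth_on_def)
qed

text \<open>A derivative of the slice in the direction \<open>v\<close> is the slice of the derivative in the direction
  \<open>(0, v)\<close>, so the claim passes from each order of differentiability to the next.\<close>

lemma smooth_on_slice:
  assumes "smooth_on (I \<times> W) F" "open I" "open W" "t \<in> I"
  shows "smooth_on W (\<lambda>y. F (t, y))"
proof -
  have "Ck_on k W (\<lambda>y. F (t, y))" if "Ck_on k (I \<times> W) F" for k
    using that
  proof (induction k arbitrary: F)
    case 0
    from 0 have "continuous_on (Pair t ` W) F"
      using assms(4) by (auto intro: continuous_on_subset)
    moreover have "continuous_on W (Pair t)"
      by (intro continuous_on_Pair continuous_on_const continuous_on_id)
    ultimately have "continuous_on W (F \<circ> Pair t)"
      by (intro continuous_on_compose)
    then show ?case by (simp add: comp_def)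
  next
    case (Suc k)
    have der: "((\<lambda>y. F (t, y)) has_derivative (\<lambda>v. frechet_derivative F (at (t, y)) (0, v))) (at y)"
      if "y \<in> W" for y
    proof -
      have "((\<lambda>y. (t, y)) has_derivative (\<lambda>v. (0, v))) (at y)"
        by (auto intro!: derivative_eq_intros)
      moreover have "(F has_derivative frechet_derivative F (at (t, y))) (at (t, y))"
        using Suc.prems that assms(4) by (simp add: frechet_derivative_works)
      ultimately show ?thesis by (rule has_derivative_compose)
    qed
    have "Ck_on k W (\<lambda>y. frechet_derivative (\<lambda>y. F (t, y)) (at y) v)" for v
    proof (rule Ck_on_cong[OF assms(3)])
      show "Ck_on k W (\<lambda>y. frechet_derivative F (at (t, y)) (0, v))"
        using Suc.IH[of "\<lambda>z. frechet_derivative F (at z) (0, v)"] Suc.prems by auto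
    qed (simp add: frechet_derivative_eqI[OF der])
    then show ?case using der by (auto simp: differentiable_def)
  qed
  then show ?thesis using assms(1) by (auto simp: smooth_on_def)
qed

lemma differentiable_cart:
  "(\<And>i. (\<lambda>x. f x $ i) differentiable (at a)) \<Longrightarrow> (f :: _ \<Rightarrow> real ^ 'm::finite) differentiable (at a)"
  by (subst differentiable_componentwise_within) (auto simp: Basis_vec_def inner_axis)

lemma differentiable_transform_open:
  assumes "f differentiable (at x)" "open U" "x \<in> U" "\<And>y. y \<in> U \<Longrightarrow> f y = g y"
  shows "g differentiable (at x)"
proof -
  obtain f' where "(f has_derivative f') (at x)"
    using assms(1) by (auto simp: differentiable_def)
  from has_derivative_transform_within_open[OF this assms(2-4)] show ?thesis
    by (auto simp: differentiable_def)
qed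


section \<open>Determinants and linear maps\<close>

lemma has_derivative_det_rows:
  fixes F :: "'m::finite \<Rightarrow> 'z::real_normed_vector \<Rightarrow> real ^ 'm"
  assumes "\<And>i. (F i has_derivative F' i) (at x)"
  shows "((\<lambda>y. det (\<chi> i. F i y)) has_derivative
    (\<lambda>h. \<Sum>i\<in>UNIV. det (\<chi> j. if j = i then F' i h else F j x))) (at x)"
proof -
  have nth: "((\<lambda>y. F i y $ k) has_derivative (\<lambda>h. F' i h $ k)) (at x)" for i k
    by (rule bounded_linear.has_derivative[OF bounded_linear_vec_nth assms])
  have "((\<lambda>y. det (\<chi> i. F i y)) has_derivative
      (\<lambda>h. \<Sum>p | p permutes UNIV. of_int (sign p) *
        (\<Sum>i\<in>UNIV. F' i h $ p i * (\<Prod>j\<in>UNIV - {i}. F j x $ p j)))) (at x)"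
    unfolding det_def vec_lambda_beta
    by (intro has_derivative_sum has_derivative_mult_right has_derivative_prod nth)
  moreover have "(\<Sum>p | p permutes UNIV. of_int (sign p) *
        (\<Sum>i\<in>UNIV. F' i h $ p i * (\<Prod>j\<in>UNIV - {i}. F j x $ p j))) =
      (\<Sum>i\<in>UNIV. det (\<chi> j. if j = i then F' i h else F j x))" for h
  proof -
    have "F' i h $ p i * (\<Prod>j\<in>UNIV - {i}. F j x $ p j) =
        (\<Prod>j\<in>UNIV. (if j = i then F' i h else F j x) $ p j)" for i p
      by (subst prod.remove[of UNIV i]) (auto intro!: prod.cong)
    then show ?thesis
      unfolding det_def by (simp add: sum_distrib_left sum.swap[of _ UNIV])
  qed
  ultimately show ?thesis by simp
qed

lemma differentiable_det_rows:
  fixes F :: "'m::finite \<Rightarrow> 'z::real_normed_vector \<Rightarrow> real ^ 'm"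
  assumes "\<And>i. F i differentiable (at x)"
  shows "(\<lambda>y. det (\<chi> i. F i y)) differentiable (at x)"
  unfolding differentiable_def
  using has_derivative_det_rows[of F "\<lambda>i. frechet_derivative (F i) (at x)" x] assms
  by (auto simp: frechet_derivative_works)

lemma det_one_row_replaced:
  "det (\<chi> j. if j = i then w else (axis j 1 :: real ^ 'm::finite)) = w $ i"
proof -
  have r: "row j (mat 1 :: real ^ 'm ^ 'm) = axis j 1" for j
    by (simp add: row_def mat_def axis_def vec_eq_iff)
  have s: "(\<Sum>k\<in>UNIV. w $ k *s row k (mat 1 :: real ^ 'm ^ 'm)) = w"
    unfolding r by (rule basis_expansion)
  show ?thesis
    using cramer_lemma_transpose[of i w "mat 1 :: real ^ 'm ^ 'm"] unfolding s unfolding r by simp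
qed

text \<open>Both sides are the derivative at \<open>t = 0\<close> of the determinant of the rows \<open>Y i + t B (Y i)\<close>,
  which is also \<open>det Y * det (I + t B)\<close>.\<close>

lemma sum_det_rows_linear_map:
  fixes Y :: "'m::finite \<Rightarrow> real ^ 'm"
  assumes "linear B"
  shows "(\<Sum>i\<in>UNIV. det (\<chi> j. if j = i then B (Y i) else Y j)) = trace (matrix B) * det (\<chi> i. Y i)"
proof -
  have 1: "((\<lambda>t::real. det (\<chi> i. Y i + t *\<^sub>R B (Y i))) has_derivative
      (\<lambda>h. \<Sum>i\<in>UNIV. det (\<chi> j. if j = i then h *\<^sub>R B (Y i) else Y j + 0 *\<^sub>R B (Y j)))) (at 0)"
    by (rule has_derivative_det_rows) (auto intro!: derivative_eq_intros)
  have 2: "((\<lambda>t::real. det (\<chi> i. axis i 1 + t *\<^sub>R row i (transpose (matrix B)))) has_derivative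
      (\<lambda>h. \<Sum>i\<in>UNIV. det (\<chi> j. if j = i then h *\<^sub>R row i (transpose (matrix B))
        else axis j 1 + 0 *\<^sub>R row j (transpose (matrix B))))) (at 0)"
    by (rule has_derivative_det_rows) (auto intro!: derivative_eq_intros)
  have eq: "det (\<chi> i. Y i + t *\<^sub>R B (Y i)) =
      det (\<chi> i. Y i) * det (\<chi> i. axis i 1 + t *\<^sub>R row i (transpose (matrix B)))" for t :: real
  proof -
    have "(\<chi> i. Y i + t *\<^sub>R B (Y i)) =
        (\<chi> i. Y i) ** (\<chi> i. axis i 1 + t *\<^sub>R row i (transpose (matrix B)))"
    proof -
      have "B (Y i) $ j = (\<Sum>k\<in>UNIV. Y i $ k * matrix B $ j $ k)" for i j
      proof -
        have "B (Y i) = matrix B *v Y i" by (simp add: matrix_works assms)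
        then show ?thesis by (simp add: matrix_vector_mult_def mult.commute)
      qed
      moreover have "(\<Sum>k\<in>UNIV. Y i $ k * axis k 1 $ j) = Y i $ j" for i j
        by (simp add: axis_def if_distrib cong: if_cong)
      ultimately show ?thesis
        by (simp add: vec_eq_iff matrix_matrix_mult_def row_def transpose_def algebra_simps
            sum.distrib flip: sum_distrib_left)
    qed
    then show ?thesis by (simp add: det_mul)
  qed
  have "(\<lambda>h. \<Sum>i\<in>UNIV. det (\<chi> j. if j = i then h *\<^sub>R B (Y i) else Y j + 0 *\<^sub>R B (Y j))) =
    (\<lambda>h. det (\<chi> i. Y i) * (\<Sum>i\<in>UNIV. det (\<chi> j. if j = i then h *\<^sub>R row i (transpose (matrix B))
        else axis j 1 + 0 *\<^sub>R row j (transpose (matrix B)))))"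
    using has_derivative_unique[OF 1] has_derivative_mult_right[OF 2, of "det (\<chi> i. Y i)"]
    by (simp add: eq)
  from fun_cong[OF this, of 1] show ?thesis
    unfolding scaleR_one scaleR_zero_left add_0_right det_one_row_replaced
    by (simp add: trace_def row_def transpose_def mult.commute)
qed

lemma linear_cart_expand:
  fixes f :: "real ^ 'm::finite \<Rightarrow> real"
  assumes "linear f"
  shows "f x = (\<Sum>i\<in>UNIV. x $ i * f (axis i 1))"
proof -
  have "f x = f (\<Sum>i\<in>UNIV. x $ i *\<^sub>R axis i 1)"
    using basis_expansion[of x] by (simp add: scalar_mult_eq_scaleR)
  then show ?thesis by (simp add: linear_sum[OF assms] linear_scale[OF assms])
qed


section \<open>Charts and tangent vectors\<close>

locale oriented_riemannian =
  fixes A :: "('a::topological_space, 'n::finite) chart set"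
    and g :: "'a \<Rightarrow> ('a, 'n) tvec \<Rightarrow> ('a, 'n) tvec \<Rightarrow> real"
  assumes atlas: "oriented_atlas A" and metric: "riemannian_metric A g"
begin

lemma chart_open: "c \<in> A \<Longrightarrow> open (cdom c)"
  and chart_image_open: "c \<in> A \<Longrightarrow> open (cmap c ` cdom c)"
  and chart_homeomorphism:
    "c \<in> A \<Longrightarrow> homeomorphism (cdom c) (cmap c ` cdom c) (cmap c) (cinv c)"
  using atlas by (auto simp: oriented_atlas_def smooth_atlas_def)

lemma cinv_cmap: "c \<in> A \<Longrightarrow> p \<in> cdom c \<Longrightarrow> cinv c (cmap c p) = p"
  using chart_homeomorphism homeomorphism_apply1 by blast

lemma chart_at: "chart_at A p \<in> A \<and> p \<in> cdom (chart_at A p)"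
proof -
  have "p \<in> (\<Union>c\<in>A. cdom c)"
    using atlas unfolding oriented_atlas_def smooth_atlas_def by (metis UNIV_I)
  then have "\<exists>c. c \<in> A \<and> p \<in> cdom c" by blast
  then show ?thesis unfolding chart_at_def by (rule someI_ex)
qed

lemma chart_overlap_open:
  assumes "c \<in> A" "open U"
  shows "open (cmap c ` (cdom c \<inter> U))"
proof -
  have "cmap c ` (cdom c \<inter> U) = cmap c ` cdom c \<inter> cinv c -` U"
    by (auto simp: cinv_cmap assms)
  moreover have "continuous_on (cmap c ` cdom c) (cinv c)"
    using chart_homeomorphism[OF assms(1)] homeomorphism_def by blast
  ultimately show ?thesis
    using continuous_open_preimage[OF _ chart_image_open[OF assms(1)] assms(2)] by simp
qed

lemma transition_smooth:
  "c \<in> A \<Longrightarrow> c' \<in> A \<Longrightarrow> smooth_on (cmap c ` (cdom c \<inter> cdom c')) (cmap c' \<circ> cinv c)"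
  using atlas by (auto simp: oriented_atlas_def smooth_atlas_def)

lemma transition_has_derivative:
  assumes "c \<in> A" "c' \<in> A" "p \<in> cdom c" "p \<in> cdom c'"
  shows "((cmap c' \<circ> cinv c) has_derivative transition_deriv c c' p) (at (cmap c p))"
  using smooth_on_differentiable[OF transition_smooth[OF assms(1,2)], of "cmap c p"] assms(3,4)
  by (simp add: transition_deriv_def frechet_derivative_works)

lemma transition_linear:
  "c \<in> A \<Longrightarrow> c' \<in> A \<Longrightarrow> p \<in> cdom c \<Longrightarrow> p \<in> cdom c' \<Longrightarrow> linear (transition_deriv c c' p)"
  using transition_has_derivative has_derivative_linear by blast

lemma transition_self:
  assumes "c \<in> A" "p \<in> cdom c"
  shows "transition_deriv c c p w = w"
proof -
  have "((\<lambda>y. y) has_derivative (\<lambda>w. w)) (at (cmap c p))"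
    by (rule has_derivative_ident)
  then have "((cmap c \<circ> cinv c) has_derivative (\<lambda>w. w)) (at (cmap c p))"
    by (rule has_derivative_transform_within_open[OF _ chart_image_open[OF assms(1)]])
      (auto simp: assms cinv_cmap)
  from has_derivative_unique[OF transition_has_derivative[OF assms(1,1,2,2)] this]
  show ?thesis by (rule fun_cong)
qed

text \<open>The chain rule for changes of coordinates; it makes the vectors \<open>tvec_of\<close> tangent vectors.\<close>

lemma transition_trans:
  assumes "c \<in> A" "c' \<in> A" "c'' \<in> A" "p \<in> cdom c" "p \<in> cdom c'" "p \<in> cdom c''"
  shows "transition_deriv c' c'' p (transition_deriv c c' p w) = transition_deriv c c'' p w"
proof -
  have eq: "(cmap c' \<circ> cinv c) (cmap c p) = cmap c' p"
    using assms by (simp add: cinv_cmap)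
  have "(cmap c'' \<circ> cinv c' has_derivative transition_deriv c' c'' p)
      (at ((cmap c' \<circ> cinv c) (cmap c p)))"
    unfolding eq using assms by (intro transition_has_derivative)
  from diff_chain_at[OF transition_has_derivative[OF assms(1,2,4,5)] this]
  have comp: "((cmap c'' \<circ> cinv c') \<circ> (cmap c' \<circ> cinv c) has_derivative
      (transition_deriv c' c'' p \<circ> transition_deriv c c' p)) (at (cmap c p))" .
  have "(cmap c'' \<circ> cinv c has_derivative
      (transition_deriv c' c'' p \<circ> transition_deriv c c' p)) (at (cmap c p))"
  proof (rule has_derivative_transform_within_open[OF comp])
    show "open (cmap c ` (cdom c \<inter> cdom c'))"
      using chart_overlap_open[OF assms(1) chart_open[OF assms(2)]] .
  qed (auto simp: assms cinv_cmap)
  from has_derivative_unique[OF this transition_has_derivative[OF assms(1,3,4,6)]]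
  have "(transition_deriv c' c'' p \<circ> transition_deriv c c' p) w = transition_deriv c c'' p w"
    by (rule fun_cong)
  then show ?thesis by (simp only: comp_apply)
qed

lemma tangent_space_transition:
  "v \<in> tangent_space A p \<Longrightarrow> c \<in> A \<Longrightarrow> c' \<in> A \<Longrightarrow> p \<in> cdom c \<Longrightarrow> p \<in> cdom c' \<Longrightarrow>
    v c' = transition_deriv c c' p (v c)"
  unfolding tangent_space_def by blast

lemma tangent_space_outside:
  "v \<in> tangent_space A p \<Longrightarrow> \<not> (c \<in> A \<and> p \<in> cdom c) \<Longrightarrow> v c = 0"
  unfolding tangent_space_def by blast

lemma tangent_spaceI:
  assumes "\<And>c c'. c \<in> A \<Longrightarrow> c' \<in> A \<Longrightarrow> p \<in> cdom c \<Longrightarrow> p \<in> cdom c' \<Longrightarrow>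
      v c' = transition_deriv c c' p (v c)"
    and "\<And>c. \<not> (c \<in> A \<and> p \<in> cdom c) \<Longrightarrow> v c = 0"
  shows "v \<in> tangent_space A p"
  using assms unfolding tangent_space_def by blast

lemma tvec_of_tangent:
  assumes "c \<in> A" "p \<in> cdom c"
  shows "tvec_of A c p w \<in> tangent_space A p"
proof (rule tangent_spaceI)
  fix c' c'' assume "c' \<in> A" "c'' \<in> A" "p \<in> cdom c'" "p \<in> cdom c''"
  then show "tvec_of A c p w c'' = transition_deriv c' c'' p (tvec_of A c p w c')"
    using assms transition_trans[of c c' c'' p w] by (simp add: tvec_of_def)
next
  fix c' assume "\<not> (c' \<in> A \<and> p \<in> cdom c')"
  then show "tvec_of A c p w c' = 0" unfolding tvec_of_def by (rule if_not_P)
qed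

lemma tvec_of_same: "c \<in> A \<Longrightarrow> p \<in> cdom c \<Longrightarrow> tvec_of A c p w c = w"
  by (simp add: tvec_of_def transition_self)

lemma tvec_of_components:
  assumes "c \<in> A" "p \<in> cdom c" "v \<in> tangent_space A p"
  shows "tvec_of A c p (v c) = v"
proof
  fix c'
  show "tvec_of A c p (v c) c' = v c'"
    using tangent_space_transition[OF assms(3,1) _ assms(2), of c']
      tangent_space_outside[OF assms(3), of c'] unfolding tvec_of_def by presburger
qed

lemma tangent_space_add:
  assumes v: "v \<in> tangent_space A p" and w: "w \<in> tangent_space A p"
  shows "tvec_add v w \<in> tangent_space A p"
proof (rule tangent_spaceI)
  fix c c' assume c: "c \<in> A" "c' \<in> A" "p \<in> cdom c" "p \<in> cdom c'"
  show "tvec_add v w c' = transition_deriv c c' p (tvec_add v w c)"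
    by (simp add: tvec_add_def linear_add[OF transition_linear[OF c]]
        tangent_space_transition[OF v c] tangent_space_transition[OF w c])
next
  fix c assume "\<not> (c \<in> A \<and> p \<in> cdom c)"
  then show "tvec_add v w c = 0"
    by (simp add: tvec_add_def tangent_space_outside[OF v] tangent_space_outside[OF w])
qed

lemma tangent_space_scale:
  assumes v: "v \<in> tangent_space A p"
  shows "tvec_scale r v \<in> tangent_space A p"
proof (rule tangent_spaceI)
  fix c c' assume c: "c \<in> A" "c' \<in> A" "p \<in> cdom c" "p \<in> cdom c'"
  show "tvec_scale r v c' = transition_deriv c c' p (tvec_scale r v c)"
    by (simp add: tvec_scale_def linear_scale[OF transition_linear[OF c]]
        tangent_space_transition[OF v c])
next
  fix c assume "\<not> (c \<in> A \<and> p \<in> cdom c)"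
  then show "tvec_scale r v c = 0"
    by (simp add: tvec_scale_def tangent_space_outside[OF v])
qed

lemma tvec_of_add:
  "c \<in> A \<Longrightarrow> p \<in> cdom c \<Longrightarrow> tvec_of A c p (v + w) = tvec_add (tvec_of A c p v) (tvec_of A c p w)"
  by (rule ext) (simp add: tvec_of_def tvec_add_def linear_add[OF transition_linear])

lemma tvec_of_scale:
  "c \<in> A \<Longrightarrow> p \<in> cdom c \<Longrightarrow> tvec_of A c p (r *\<^sub>R v) = tvec_scale r (tvec_of A c p v)"
  by (rule ext) (simp add: tvec_of_def tvec_scale_def linear_scale[OF transition_linear])

lemma coord_field_tangent:
  "c \<in> A \<Longrightarrow> p \<in> cdom c \<Longrightarrow> coord_field A c i p \<in> tangent_space A p"
  unfolding coord_field_def by (rule tvec_of_tangent)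

lemma coord_field_same: "c \<in> A \<Longrightarrow> p \<in> cdom c \<Longrightarrow> coord_field A c i p c = axis i 1"
  unfolding coord_field_def by (rule tvec_of_same)

text \<open>In a second chart \<open>c'\<close> the components are the partial derivatives of the change of coordinates
  from \<open>c\<close> to \<open>c'\<close>, composed with the change of coordinates from \<open>c'\<close> to \<open>c\<close>.\<close>

lemma coord_field_smooth:
  assumes "c \<in> A"
  shows "smooth_vector_field_on A (cdom c) (coord_field A c i)"
  unfolding smooth_vector_field_on_def
proof (intro conjI ballI)
  fix c' assume c': "c' \<in> A"
  let ?W = "cmap c' ` (cdom c' \<inter> cdom c)" and ?T = "cmap c ` (cdom c \<inter> cdom c')"
  have W: "open ?W" and T: "open ?T"
    using assms c' chart_open chart_overlap_open by blast+
  have sm: "smooth_on ?T (\<lambda>z. frechet_derivative (cmap c' \<circ> cinv c) (at z) (axis i 1))"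
    by (rule smooth_on_derivative[OF transition_smooth[OF assms c']])
  have img: "(cmap c \<circ> cinv c') ` ?W \<subseteq> ?T"
    by (auto simp: cinv_cmap c')
  have "Ck_on k ?W (\<lambda>y. coord_field A c i (cinv c' y) c')" for k
  proof (rule Ck_on_cong[OF W])
    show "Ck_on k ?W ((\<lambda>z. frechet_derivative (cmap c' \<circ> cinv c) (at z) (axis i 1))
        \<circ> (cmap c \<circ> cinv c'))"
      using Ck_on_compose[OF W T img] sm transition_smooth[OF c' assms] 
      unfolding smooth_on_def by blast
  next
    fix y assume "y \<in> ?W"
    then show "((\<lambda>z. frechet_derivative (cmap c' \<circ> cinv c) (at z) (axis i 1))
        \<circ> (cmap c \<circ> cinv c')) y = coord_field A c i (cinv c' y) c'"
      using c' by (auto simp: cinv_cmap coord_field_def tvec_of_def transition_deriv_def comp_def)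
  qed
  then show "smooth_on ?W (\<lambda>y. coord_field A c i (cinv c' y) c')"
    unfolding smooth_on_def by blast
qed (use assms coord_field_tangent in blast)


section \<open>The metric and the volume form in charts\<close>

lemma metric_add_left:
  "u \<in> tangent_space A p \<Longrightarrow> v \<in> tangent_space A p \<Longrightarrow> w \<in> tangent_space A p \<Longrightarrow>
    g p (tvec_add u v) w = g p u w + g p v w"
  and metric_scale_left:
  "u \<in> tangent_space A p \<Longrightarrow> w \<in> tangent_space A p \<Longrightarrow> g p (tvec_scale r u) w = r * g p u w"
  and metric_sym: "u \<in> tangent_space A p \<Longrightarrow> w \<in> tangent_space A p \<Longrightarrow> g p u w = g p w u"
  and metric_pos: "u \<in> tangent_space A p \<Longrightarrow> u \<noteq> (\<lambda>c. 0) \<Longrightarrow> g p u u > 0"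
  using metric unfolding riemannian_metric_def by blast+

lemma metric_add_right:
  "u \<in> tangent_space A p \<Longrightarrow> v \<in> tangent_space A p \<Longrightarrow> w \<in> tangent_space A p \<Longrightarrow>
    g p w (tvec_add u v) = g p w u + g p w v"
  by (simp add: metric_sym[of w] tangent_space_add metric_add_left)

lemma metric_scale_right:
  "u \<in> tangent_space A p \<Longrightarrow> w \<in> tangent_space A p \<Longrightarrow> g p w (tvec_scale r u) = r * g p w u"
  by (simp add: metric_sym[of w] tangent_space_scale metric_scale_left)

lemmas metric_simps = metric_add_left metric_add_right metric_scale_left metric_scale_right
  tangent_space_add tangent_space_scale

lemma metric_linear_tvec_of:
  assumes "c \<in> A" "p \<in> cdom c" "w \<in> tangent_space A p"
  shows "linear (\<lambda>x. g p w (tvec_of A c p x))" "linear (\<lambda>x. g p (tvec_of A c p x) w)"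
  by (auto intro!: linearI
      simp: assms tvec_of_add tvec_of_scale metric_simps tvec_of_tangent)

text \<open>Bilinearity holds only on tangent spaces, so the components are first turned back into tangent
  vectors and the metric is then expanded in the basis of coordinate fields.\<close>

lemma metric_in_chart:
  assumes c: "c \<in> A" "p \<in> cdom c" and "v \<in> tangent_space A p" "w \<in> tangent_space A p"
  shows "g p v w = v c \<bullet> (gram A g c p *v w c)"
proof -
  have "g p v w = g p (tvec_of A c p (v c)) (tvec_of A c p (w c))"
    using tvec_of_components[OF c] assms by simp
  also have "\<dots> = (\<Sum>i\<in>UNIV. v c $ i * g p (coord_field A c i p) (tvec_of A c p (w c)))"
    unfolding coord_field_def
    by (rule linear_cart_expand[OF metric_linear_tvec_of(2)]) (simp_all add: c tvec_of_tangent)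
  also have "\<dots> = (\<Sum>i\<in>UNIV. v c $ i *
      (\<Sum>j\<in>UNIV. w c $ j * g p (coord_field A c i p) (coord_field A c j p)))"
    by (subst linear_cart_expand[OF metric_linear_tvec_of(1)[OF c]])
      (simp_all add: c coord_field_tangent coord_field_def tvec_of_tangent)
  also have "\<dots> = v c \<bullet> (gram A g c p *v w c)"
    by (simp add: inner_vec_def matrix_vector_mult_def gram_def mult.commute)
  finally show ?thesis .
qed

text \<open>An element of the kernel of \<open>g\<^sub>i\<^sub>j\<close> is a tangent vector of length zero.\<close>

lemma gram_det_nonzero:
  assumes c: "c \<in> A" "p \<in> cdom c"
  shows "det (gram A g c p) \<noteq> 0"
proof -
  have "x = 0" if "gram A g c p *v x = 0" for x
  proof -
    let ?v = "tvec_of A c p x"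
    have v: "?v \<in> tangent_space A p" "?v c = x"
      using c tvec_of_tangent tvec_of_same by auto
    then have "g p ?v ?v = 0" using metric_in_chart[OF c v(1) v(1)] that by simp
    then have "?v = (\<lambda>c. 0)" using metric_pos[OF v(1)] by fastforce
    then show ?thesis using v(2) by (metis)
  qed
  then have "invertible (gram A g c p)"
    using matrix_left_invertible_ker[of "gram A g c p"] invertible_left_inverse by blast
  then show ?thesis using invertible_det_nz by blast
qed

text \<open>Used for determinants: \<open>det g\<^sub>i\<^sub>j\<close> is multiplied by the square of the Jacobian determinant.\<close>

lemma gram_transition:
  assumes c: "c \<in> A" "p \<in> cdom c" and c': "c' \<in> A" "p \<in> cdom c'"
  defines "J \<equiv> matrix (transition_deriv c c' p)"
  shows "gram A g c p = transpose J ** gram A g c' p ** J"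
proof -
  have J: "coord_field A c i p c' = J *v axis i 1" for i
    using c c' by (simp add: coord_field_def tvec_of_def J_def matrix_works transition_linear)
  have "gram A g c p $ i $ j = (transpose J ** gram A g c' p ** J) $ i $ j" for i j
  proof -
    have "gram A g c p $ i $ j = (J *v axis i 1) \<bullet> (gram A g c' p *v (J *v axis j 1))"
      using metric_in_chart[OF c' coord_field_tangent[OF c] coord_field_tangent[OF c], of i j]
      by (simp add: gram_def[of A g c] J)
    also have "\<dots> = axis i 1 \<bullet> ((transpose J ** gram A g c' p ** J) *v axis j 1)"
      using dot_lmul_matrix[of "axis i 1" "transpose J"]
      by (simp add: matrix_vector_mul_assoc matrix_mul_assoc del: transpose_matrix_vector)
    also have "\<dots> = (transpose J ** gram A g c' p ** J) $ i $ j"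
      by (simp add: inner_axis' matrix_vector_mul_component[of _ "axis j 1"] inner_axis del: matrix_vector_mult_basis)
    finally show ?thesis .
  qed
  then show ?thesis by (simp add: vec_eq_iff)
qed

text \<open>From one chart to another \<open>det Y\<close> is multiplied by the Jacobian determinant \<open>J\<close> and
  \<open>\<surd>(det g\<^sub>i\<^sub>j)\<close> is divided by \<open>\<bar>J\<bar>\<close>; these cancel because the atlas is oriented.\<close>

lemma vol_form_in_chart:
  assumes c: "c \<in> A" "p \<in> cdom c" and Y: "\<And>i. Y i \<in> tangent_space A p"
  shows "vol_form A g p Y = sqrt (det (gram A g c p)) * det (\<chi> i. Y i c)"
proof -
  let ?c = "chart_at A p"
  have c': "?c \<in> A" "p \<in> cdom ?c" using chart_at by auto
  define J where "J = matrix (transition_deriv c ?c p)"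
  have pos: "det J > 0"
    using atlas c c' unfolding oriented_atlas_def J_def by blast
  have "J *v w = transition_deriv c ?c p w" for w
    using transition_linear[OF c(1) c'(1) c(2) c'(2)] by (simp add: J_def matrix_works)
  then have "Y i ?c = J *v Y i c" for i
    by (simp only:) (rule tangent_space_transition[OF Y c(1) c'(1) c(2) c'(2)])
  then have "(\<chi> i. Y i ?c) = (\<chi> i. Y i c) ** transpose J"
    by (simp add: vec_eq_iff matrix_matrix_mult_def matrix_vector_mult_def transpose_def mult.commute)
  then have Y: "det (\<chi> i. Y i ?c) = det J * det (\<chi> i. Y i c)"
    by (simp add: det_mul)
  have "det (gram A g c p) = (det J)\<^sup>2 * det (gram A g ?c p)"
    unfolding gram_transition[OF c c'] J_def[symmetric]
    by (simp add: det_mul power2_eq_square)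
  then have "sqrt (det (gram A g c p)) = det J * sqrt (det (gram A g ?c p))"
    using pos by (simp add: real_sqrt_mult)
  then show ?thesis by (simp add: vol_form_def Let_def Y)
qed


section \<open>Gradients\<close>

text \<open>The product and chain rules only involve the derivatives that occur in their statements.  Working
  with these classes replaces smoothness of \<open>\<surd>\<rho>\<close>, \<open>cos \<theta>\<close> and their products by closure properties
  that come with the formulas for the derivatives.\<close>

definition differentiable_fun :: "('a \<Rightarrow> real) \<Rightarrow> bool" where
  "differentiable_fun f \<longleftrightarrow>
     (\<forall>c\<in>A. \<forall>p\<in>cdom c. (f \<circ> cinv c) differentiable (at (cmap c p)))"

definition differentiable_field :: "('a \<Rightarrow> ('a, 'n) tvec) \<Rightarrow> bool" where
  "differentiable_field Z \<longleftrightarrow> (\<forall>p. Z p \<in> tangent_space A p) \<and>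
     (\<forall>c\<in>A. \<forall>p\<in>cdom c. (\<lambda>y. Z (cinv c y) c) differentiable (at (cmap c p)))"

text \<open>Differentiability of the gradient as a vector field is what the formula for its divergence needs;
  it is inherited by compositions through the formula for their gradients.\<close>

definition twice_differentiable_fun :: "('a \<Rightarrow> real) \<Rightarrow> bool" where
  "twice_differentiable_fun f \<longleftrightarrow> differentiable_fun f \<and> differentiable_field (grad A g f)"

lemma differentiable_funD:
  "differentiable_fun f \<Longrightarrow> c \<in> A \<Longrightarrow> p \<in> cdom c \<Longrightarrow>
    ((f \<circ> cinv c) has_derivative frechet_derivative (f \<circ> cinv c) (at (cmap c p))) (at (cmap c p))"
  unfolding differentiable_fun_def frechet_derivative_works by blast

lemma differentiable_field_tangent: "differentiable_field Z \<Longrightarrow> Z p \<in> tangent_space A p"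
  unfolding differentiable_field_def by blast

lemma differentiable_fieldD:
  "differentiable_field Z \<Longrightarrow> c \<in> A \<Longrightarrow> p \<in> cdom c \<Longrightarrow>
    (\<lambda>y. Z (cinv c y) c) differentiable (at (cmap c p))"
  unfolding differentiable_field_def by blast

lemma smooth_imp_differentiable_fun: "smooth_fun A f \<Longrightarrow> differentiable_fun f"
  unfolding smooth_fun_def differentiable_fun_def
  by (intro ballI smooth_on_differentiable[of "cmap _ ` cdom _"]) auto

text \<open>\<open>differential\<close> is evaluated in a chart that may change from point to point.  To differentiate the
  gradient, the differential has to be expressed in one chart on the whole domain of this chart.\<close>

lemma differential_in_chart:
  assumes f: "differentiable_fun f" and c: "c \<in> A" "p \<in> cdom c" and v: "v \<in> tangent_space A p"
  shows "differential A f p v = frechet_derivative (f \<circ> cinv c) (at (cmap c p)) (v c)"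
proof -
  let ?c = "chart_at A p"
  have c': "?c \<in> A" "p \<in> cdom ?c" using chart_at by auto
  have eq: "(cmap ?c \<circ> cinv c) (cmap c p) = cmap ?c p"
    using c by (simp add: cinv_cmap)
  have "((f \<circ> cinv ?c) has_derivative frechet_derivative (f \<circ> cinv ?c) (at (cmap ?c p)))
      (at ((cmap ?c \<circ> cinv c) (cmap c p)))"
    unfolding eq by (rule differentiable_funD[OF f c'])
  from diff_chain_at[OF transition_has_derivative[OF c(1) c'(1) c(2) c'(2)] this]
  have comp: "((f \<circ> cinv ?c) \<circ> (cmap ?c \<circ> cinv c) has_derivative
      (frechet_derivative (f \<circ> cinv ?c) (at (cmap ?c p)) \<circ> transition_deriv c ?c p))
      (at (cmap c p))" .
  have "(f \<circ> cinv c has_derivative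
      (frechet_derivative (f \<circ> cinv ?c) (at (cmap ?c p)) \<circ> transition_deriv c ?c p))
      (at (cmap c p))"
  proof (rule has_derivative_transform_within_open[OF comp])
    show "open (cmap c ` (cdom c \<inter> cdom ?c))"
      using chart_overlap_open[OF c(1) chart_open[OF c'(1)]] .
  qed (use c' in \<open>auto simp: c cinv_cmap\<close>)
  then have "frechet_derivative (f \<circ> cinv c) (at (cmap c p)) (v c) =
      frechet_derivative (f \<circ> cinv ?c) (at (cmap ?c p)) (transition_deriv c ?c p (v c))"
    by (simp only: frechet_derivative_eqI comp_apply)
  also have "transition_deriv c ?c p (v c) = v ?c"
    by (rule tangent_space_transition[OF v c(1) c'(1) c(2) c'(2), symmetric])
  finally show ?thesis unfolding differential_def Let_def by (rule sym)
qed

lemma differential_mult: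
  assumes "differentiable_fun u" "differentiable_fun v"
  shows "differential A (\<lambda>x. u x * v x) p w =
    u p * differential A v p w + v p * differential A u p w"
proof -
  let ?c = "chart_at A p"
  have c: "?c \<in> A" "p \<in> cdom ?c" using chart_at by auto
  have "((\<lambda>y. (u \<circ> cinv ?c) y * (v \<circ> cinv ?c) y) has_derivative
    (\<lambda>h. (u \<circ> cinv ?c) (cmap ?c p) * frechet_derivative (v \<circ> cinv ?c) (at (cmap ?c p)) h +
      frechet_derivative (u \<circ> cinv ?c) (at (cmap ?c p)) h * (v \<circ> cinv ?c) (cmap ?c p)))
    (at (cmap ?c p))"
    by (rule has_derivative_mult[OF differentiable_funD[OF assms(1) c]
          differentiable_funD[OF assms(2) c]])
  then show ?thesis
    unfolding differential_def Let_def comp_def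
    by (simp add: frechet_derivative_eqI cinv_cmap[OF c])
qed

lemma differentiable_fun_mult:
  assumes "differentiable_fun u" "differentiable_fun v"
  shows "differentiable_fun (\<lambda>x. u x * v x)"
  using assms unfolding differentiable_fun_def comp_def by (simp add: differentiable_mult)

lemma compose_has_derivative:
  assumes "differentiable_fun u" and c: "c \<in> A" "p \<in> cdom c"
    and F: "(F has_real_derivative F') (at (u p))"
  shows "((\<lambda>x. F (u x)) \<circ> cinv c has_derivative
    (\<lambda>h. F' * frechet_derivative (u \<circ> cinv c) (at (cmap c p)) h)) (at (cmap c p))"
proof -
  have "(F has_derivative (*) F') (at ((u \<circ> cinv c) (cmap c p)))"
    using F by (simp add: has_field_derivative_def cinv_cmap[OF c])
  from has_derivative_compose[OF differentiable_funD[OF assms(1) c] this]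
  show ?thesis by (simp add: comp_def)
qed

lemma differential_compose:
  assumes "differentiable_fun u" and "(F has_real_derivative F') (at (u p))"
  shows "differential A (\<lambda>x. F (u x)) p w = F' * differential A u p w"
proof -
  have c: "chart_at A p \<in> A" "p \<in> cdom (chart_at A p)" using chart_at by auto
  show ?thesis
    unfolding differential_def Let_def
      frechet_derivative_eqI[OF compose_has_derivative[OF assms(1) c assms(2)]] by (rule refl)
qed

lemma differentiable_fun_compose:
  assumes "differentiable_fun u" and "\<And>x. (F has_real_derivative F' x) (at (u x))"
  shows "differentiable_fun (\<lambda>x. F (u x))"
  unfolding differentiable_fun_def differentiable_def
  using compose_has_derivative[OF assms(1) _ _ assms(2)] by blast

text \<open>The difference of the two vectors is orthogonal to itself.\<close>

lemma metric_nondegenerate: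
  assumes v: "v \<in> tangent_space A p" and v': "v' \<in> tangent_space A p"
    and eq: "\<And>w. w \<in> tangent_space A p \<Longrightarrow> g p v w = g p v' w"
  shows "v = v'"
proof -
  let ?u = "tvec_add v (tvec_scale (-1) v')"
  have u: "?u \<in> tangent_space A p"
    using v v' by (intro tangent_space_add tangent_space_scale)
  have "g p ?u ?u = g p v ?u - g p v' ?u"
    by (subst metric_add_left) (simp_all add: u v v' tangent_space_scale metric_scale_left)
  then have "g p ?u ?u = 0" using eq[OF u] by simp
  then have "?u = (\<lambda>c. 0)" using metric_pos[OF u] by fastforce
  then show ?thesis by (simp add: tvec_add_def tvec_scale_def fun_eq_iff)
qed

lemma grad_eqI:
  assumes v: "v \<in> tangent_space A p"
    and eq: "\<And>w. w \<in> tangent_space A p \<Longrightarrow> g p v w = differential A f p w"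
  shows "grad A g f p = v"
  unfolding grad_def
proof (rule the_equality)
  fix v' assume v': "v' \<in> tangent_space A p \<and> (\<forall>w\<in>tangent_space A p. g p v' w = differential A f p w)"
  show "v' = v"
  proof (rule metric_nondegenerate)
    fix w assume "w \<in> tangent_space A p"
    with v' eq show "g p v' w = g p v w" by metis
  qed (use v v' in blast)+
qed (use assms in simp)

text \<open>In the chart \<open>chart_at A p\<close> the defining equation is the linear system
  \<open>\<Sum>\<^sub>j g\<^sub>i\<^sub>j x\<^sup>j = \<partial>\<^sub>i f\<close>, which has a solution because \<open>det g\<^sub>i\<^sub>j\<close> does not vanish.\<close>

lemma grad_works:
  assumes f: "differentiable_fun f"
  shows "grad A g f p \<in> tangent_space A p"
    and "w \<in> tangent_space A p \<Longrightarrow> g p (grad A g f p) w = differential A f p w"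
proof -
  let ?c = "chart_at A p"
  have c: "?c \<in> A" "p \<in> cdom ?c" using chart_at by auto
  let ?D = "frechet_derivative (f \<circ> cinv ?c) (at (cmap ?c p))"
  have lin: "linear ?D" using differentiable_funD[OF f c] by (rule has_derivative_linear)
  have "\<exists>x. gram A g ?c p *v x = (\<chi> i. ?D (axis i 1))"
    using cramer[OF gram_det_nonzero[OF c]] by blast
  then obtain x where x: "gram A g ?c p *v x = (\<chi> i. ?D (axis i 1))" by blast
  define v where "v = tvec_of A ?c p x"
  have v: "v \<in> tangent_space A p" "v ?c = x"
    unfolding v_def using c tvec_of_tangent tvec_of_same by auto
  have eq: "g p v w = differential A f p w" if w: "w \<in> tangent_space A p" for w
  proof -
    have "g p v w = w ?c \<bullet> (\<chi> i. ?D (axis i 1))"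
      using metric_in_chart[OF c w v(1)] metric_sym[OF v(1) w] v(2) x by simp
    also have "\<dots> = ?D (w ?c)"
      unfolding linear_cart_expand[OF lin, of "w ?c"] by (simp add: inner_vec_def)
    finally show ?thesis unfolding differential_def Let_def .
  qed
  have "grad A g f p = v" using v(1) eq by (rule grad_eqI)
  then show "grad A g f p \<in> tangent_space A p"
    and "w \<in> tangent_space A p \<Longrightarrow> g p (grad A g f p) w = differential A f p w"
    using v(1) eq by auto
qed

lemma grad_in_chart:
  assumes f: "differentiable_fun f" and c: "c \<in> A" "p \<in> cdom c"
  shows "grad A g f p c $ k = det (\<chi> i. \<chi> j. if j = k
      then frechet_derivative (f \<circ> cinv c) (at (cmap c p)) (axis i 1) else gram A g c p $ i $ j)
    / det (gram A g c p)"
proof -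
  let ?D = "frechet_derivative (f \<circ> cinv c) (at (cmap c p))"
  have "(gram A g c p *v grad A g f p c) $ i = ?D (axis i 1)" for i
  proof -
    have e: "coord_field A c i p \<in> tangent_space A p" "coord_field A c i p c = axis i 1"
      using c coord_field_tangent coord_field_same by auto
    have "(gram A g c p *v grad A g f p c) $ i = g p (coord_field A c i p) (grad A g f p)"
      unfolding metric_in_chart[OF c e(1) grad_works(1)[OF f]] e(2) by (simp add: inner_axis')
    also have "\<dots> = differential A f p (coord_field A c i p)"
      using metric_sym[OF e(1) grad_works(1)[OF f]] grad_works(2)[OF f e(1)] by simp
    also have "\<dots> = ?D (axis i 1)"
      using differential_in_chart[OF f c e(1)] e(2) by simp
    finally show ?thesis .
  qed
  then have "gram A g c p *v grad A g f p c = (\<chi> i. ?D (axis i 1))"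
    by (simp add: vec_eq_iff)
  then show ?thesis
    unfolding cramer[OF gram_det_nonzero[OF c]] by (simp cong: if_cong)
qed

lemma gram_differentiable:
  assumes c: "c \<in> A" "p \<in> cdom c"
  shows "(\<lambda>y. gram A g c (cinv c y) $ i $ j) differentiable (at (cmap c p))"
  using metric c unfolding riemannian_metric_def
  by (intro smooth_on_differentiable[of "cmap c ` cdom c"]) auto

lemma gram_det_differentiable:
  assumes c: "c \<in> A" "p \<in> cdom c"
  shows "(\<lambda>y. det (gram A g c (cinv c y))) differentiable (at (cmap c p))"
proof -
  have "(\<lambda>y. det (\<chi> i. gram A g c (cinv c y) $ i)) differentiable (at (cmap c p))"
    by (intro differentiable_det_rows differentiable_cart gram_differentiable c)
  then show ?thesis by simp
qed

text \<open>By Cramer's rule the components of the gradient are quotients of determinants in the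
  coefficients of the metric and the partial derivatives of the function.\<close>

lemma smooth_imp_twice_differentiable:
  assumes "smooth_fun A f"
  shows "twice_differentiable_fun f"
proof -
  have f: "differentiable_fun f" using assms by (rule smooth_imp_differentiable_fun)
  have "(\<lambda>y. grad A g f (cinv c y) c) differentiable (at (cmap c p))"
    if c: "c \<in> A" "p \<in> cdom c" for c p
  proof (rule differentiable_cart)
    fix k
    let ?R = "\<lambda>i y. (\<chi> j. if j = k then frechet_derivative (f \<circ> cinv c) (at y) (axis i 1)
      else gram A g c (cinv c y) $ i $ j) :: real ^ 'n"
    have sm: "smooth_on (cmap c ` cdom c) (f \<circ> cinv c)"
      using assms c unfolding smooth_fun_def by blast
    have "?R i differentiable (at (cmap c p))" for i
    proof (rule differentiable_cart)
      fix j
      have "(\<lambda>y. frechet_derivative (f \<circ> cinv c) (at y) (axis i 1)) differentiable (at (cmap c p))"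
        using c by (intro smooth_on_differentiable[OF smooth_on_derivative[OF sm]]) blast
      then show "(\<lambda>y. ?R i y $ j) differentiable (at (cmap c p))"
        using gram_differentiable[OF c] by (cases "j = k") simp_all
    qed
    then have "(\<lambda>y. det (\<chi> i. ?R i y) / det (gram A g c (cinv c y)))
        differentiable (at (cmap c p))"
      using c by (intro differentiable_divide differentiable_det_rows gram_det_differentiable)
        (simp_all add: gram_det_nonzero cinv_cmap)
    then show "(\<lambda>y. grad A g f (cinv c y) c $ k) differentiable (at (cmap c p))"
    proof (rule differentiable_transform_open[OF _ chart_image_open[OF c(1)]])
      fix y assume "y \<in> cmap c ` cdom c"
      then obtain q where q: "q \<in> cdom c" "y = cmap c q" by blast
      show "det (\<chi> i. ?R i y) / det (gram A g c (cinv c y)) = grad A g f (cinv c y) c $ k"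
        unfolding q(2) cinv_cmap[OF c(1) q(1)] grad_in_chart[OF f c(1) q(1)] by (rule refl)
    qed (use c in blast)
  qed
  then show ?thesis
    using f grad_works(1)[OF f] unfolding twice_differentiable_fun_def differentiable_field_def by blast
qed

lemma grad_mult:
  assumes u: "differentiable_fun u" and v: "differentiable_fun v"
  shows "grad A g (\<lambda>x. u x * v x) p =
    tvec_add (tvec_scale (u p) (grad A g v p)) (tvec_scale (v p) (grad A g u p))"
proof (rule grad_eqI)
  show "tvec_add (tvec_scale (u p) (grad A g v p)) (tvec_scale (v p) (grad A g u p))
      \<in> tangent_space A p"
    by (intro tangent_space_add tangent_space_scale grad_works(1) u v)
  fix w assume w: "w \<in> tangent_space A p"
  show "g p (tvec_add (tvec_scale (u p) (grad A g v p)) (tvec_scale (v p) (grad A g u p))) w =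
      differential A (\<lambda>x. u x * v x) p w"
    using w by (simp add: metric_simps grad_works[OF u] grad_works[OF v] differential_mult[OF u v])
qed

lemma grad_compose:
  assumes u: "differentiable_fun u" and F: "(F has_real_derivative F') (at (u p))"
  shows "grad A g (\<lambda>x. F (u x)) p = tvec_scale F' (grad A g u p)"
proof (rule grad_eqI)
  show "tvec_scale F' (grad A g u p) \<in> tangent_space A p"
    by (intro tangent_space_scale grad_works(1) u)
  fix w assume w: "w \<in> tangent_space A p"
  show "g p (tvec_scale F' (grad A g u p)) w = differential A (\<lambda>x. F (u x)) p w"
    using w by (simp add: metric_simps grad_works[OF u] differential_compose[OF u F])
qed


section \<open>Divergence and Laplacian\<close>

lemma volume_density_nonzero:
  "c \<in> A \<Longrightarrow> p \<in> cdom c \<Longrightarrow> sqrt (det (gram A g c (cinv c (cmap c p)))) \<noteq> 0"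
  by (simp add: cinv_cmap gram_det_nonzero)

text \<open>The real square root is an odd function, differentiable at every point except \<open>0\<close>.\<close>

lemma volume_density_has_derivative:
  assumes c: "c \<in> A" "p \<in> cdom c"
  defines "s \<equiv> \<lambda>y. sqrt (det (gram A g c (cinv c y)))"
  shows "(s has_derivative frechet_derivative s (at (cmap c p))) (at (cmap c p))"
proof -
  let ?d = "det (gram A g c p)"
  have "sqrt differentiable (at (det (gram A g c (cinv c (cmap c p)))))"
    unfolding cinv_cmap[OF c] real_differentiable_def
    \<comment> \<open>one formula for the derivative of the square root on both sides of \<open>0\<close>\<close>
    by (rule exI, rule DERIV_real_sqrt_generic[OF gram_det_nonzero[OF c],
          where D = "sgn ?d * inverse (sqrt ?d) / 2"]) simp_all
  then have "s differentiable (at (cmap c p))"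
    unfolding s_def by (rule differentiable_compose) (rule gram_det_differentiable[OF c])
  then show ?thesis by (simp add: frechet_derivative_works)
qed

text \<open>In the chart \<open>c\<close> this is the computation
  \<open>L\<^sub>Z(s dx\<^sup>1 \<and> \<dots> \<and> dx\<^sup>n)(Y\<^sub>1, \<dots>, Y\<^sub>n) = d(s det Y)(Z) - s \<Sum>\<^sub>i det(Y; DY\<^sub>i(Z) - DZ(Y\<^sub>i) in row i)\<close> with
  \<open>s = \<surd>(det g\<^sub>i\<^sub>j)\<close>: the terms with \<open>DY\<^sub>i\<close> cancel, and those with \<open>DZ\<close> add up to a trace.\<close>

lemma lie_derivative_vol_form:
  fixes Z :: "'a \<Rightarrow> ('a, 'n) tvec" and p :: 'a
  defines "c \<equiv> chart_at A p"
  defines "DZ \<equiv> frechet_derivative (\<lambda>y. Z (cinv c y) c) (at (cmap c p))"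
    and "s \<equiv> \<lambda>y. sqrt (det (gram A g c (cinv c y)))"
  assumes Z: "(\<lambda>y. Z (cinv c y) c) differentiable (at (cmap c p))"
    and U: "open U" "p \<in> U" and Y: "\<And>i. smooth_vector_field_on A U (Y i)"
  shows "lie_derivative A Z (vol_form A g) Y p =
    (trace (matrix DZ) + frechet_derivative s (at (cmap c p)) (Z p c) / s (cmap c p))
      * vol_form A g p (\<lambda>i. Y i p)"
proof -
  have c: "c \<in> A" "p \<in> cdom c" unfolding c_def using chart_at by auto
  define z where "z = Z p c"
  define Yp where "Yp = (\<lambda>i. Y i p c)"
  define DY where "DY = (\<lambda>i. frechet_derivative (\<lambda>y. Y i (cinv c y) c) (at (cmap c p)))"
  define Ds where "Ds = frechet_derivative s (at (cmap c p))"
  have s0: "s (cmap c p) = sqrt (det (gram A g c p))" "s (cmap c p) \<noteq> 0"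
    using volume_density_nonzero[OF c] by (simp_all add: s_def cinv_cmap[OF c])
  have s: "(s has_derivative Ds) (at (cmap c p))"
    unfolding Ds_def s_def by (rule volume_density_has_derivative[OF c])
  have YD: "((\<lambda>y. Y i (cinv c y) c) has_derivative DY i) (at (cmap c p))" for i
  proof -
    have "smooth_on (cmap c ` (cdom c \<inter> U)) (\<lambda>y. Y i (cinv c y) c)"
      using Y[of i] c unfolding smooth_vector_field_on_def by blast
    then have "(\<lambda>y. Y i (cinv c y) c) differentiable (at (cmap c p))"
      by (rule smooth_on_differentiable) (use c U in blast)
    then show ?thesis by (simp add: DY_def frechet_derivative_works)
  qed
  have lin: "linear DZ" using Z unfolding frechet_derivative_works DZ_def by (rule has_derivative_linear)
  have "((\<lambda>y. s y * det (\<chi> i. Y i (cinv c y) c)) has_derivative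
      (\<lambda>h. s (cmap c p) * (\<Sum>i\<in>UNIV. det (\<chi> j. if j = i then DY i h else Y j (cinv c (cmap c p)) c))
        + Ds h * det (\<chi> i. Y i (cinv c (cmap c p)) c))) (at (cmap c p))"
    by (rule has_derivative_mult[OF s has_derivative_det_rows[OF YD]])
  then have "((\<lambda>q. vol_form A g q (\<lambda>i. Y i q)) \<circ> cinv c has_derivative
      (\<lambda>h. s (cmap c p) * (\<Sum>i\<in>UNIV. det (\<chi> j. if j = i then DY i h else Y j (cinv c (cmap c p)) c))
        + Ds h * det (\<chi> i. Y i (cinv c (cmap c p)) c))) (at (cmap c p))"
  proof (rule has_derivative_transform_within_open)
    show "open (cmap c ` (cdom c \<inter> U))" by (rule chart_overlap_open[OF c(1) U(1)])
    show "cmap c p \<in> cmap c ` (cdom c \<inter> U)" using c U by blast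
    fix y assume "y \<in> cmap c ` (cdom c \<inter> U)"
    then obtain q where q: "q \<in> cdom c" "q \<in> U" "y = cmap c q" by blast
    have "Y i q \<in> tangent_space A q" for i
      using Y[of i] q(2) unfolding smooth_vector_field_on_def by blast
    from vol_form_in_chart[OF c(1) q(1), of "\<lambda>i. Y i q", OF this]
    show "s y * det (\<chi> i. Y i (cinv c y) c) = ((\<lambda>q. vol_form A g q (\<lambda>i. Y i q)) \<circ> cinv c) y"
      by (simp add: s_def q(3) cinv_cmap[OF c(1) q(1)])
  qed
  then have 1: "differential A (\<lambda>q. vol_form A g q (\<lambda>i. Y i q)) p (Z p) =
      s (cmap c p) * (\<Sum>i\<in>UNIV. det (\<chi> j. if j = i then DY i z else Yp j)) + Ds z * det (\<chi> i. Yp i)"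
    unfolding differential_def Let_def c_def[symmetric]
    by (simp only: frechet_derivative_eqI cinv_cmap[OF c] z_def Yp_def)
  have 2: "vol_form A g p ((\<lambda>j. Y j p)(i := lie_bracket A Z (Y i) p)) =
      s (cmap c p) * (det (\<chi> j. if j = i then DY i z else Yp j)
        - det (\<chi> j. if j = i then DZ (Yp i) else Yp j))" for i
  proof -
    have b: "lie_bracket A Z (Y i) p c = DY i z - DZ (Yp i)"
      using c by (simp add: lie_bracket_def DY_def DZ_def z_def Yp_def)
    have "det (\<chi> j. if j = i then DY i z else Yp j) =
        det (\<chi> j. if j = i then (DY i z - DZ (Yp i)) + DZ (Yp i) else Yp j)"
      by (simp only: diff_add_cancel)
    also have "\<dots> = det (\<chi> j. if j = i then DY i z - DZ (Yp i) else Yp j)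
        + det (\<chi> j. if j = i then DZ (Yp i) else Yp j)"
      by (rule det_row_add)
    finally have "det (\<chi> j. if j = i then DY i z - DZ (Yp i) else Yp j) =
        det (\<chi> j. if j = i then DY i z else Yp j) - det (\<chi> j. if j = i then DZ (Yp i) else Yp j)"
      by simp
    moreover have "((\<lambda>j. Y j p)(i := lie_bracket A Z (Y i) p)) j c =
        (if j = i then DY i z - DZ (Yp i) else Yp j)" for j
      by (simp add: b Yp_def)
    ultimately show ?thesis
      unfolding vol_form_def Let_def c_def[symmetric] s0(1) by simp
  qed
  have 3: "vol_form A g p (\<lambda>i. Y i p) = s (cmap c p) * det (\<chi> i. Yp i)"
    by (simp add: vol_form_def Let_def c_def[symmetric] s0(1) Yp_def)
  have "lie_derivative A Z (vol_form A g) Y p =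
      Ds z * det (\<chi> i. Yp i) + s (cmap c p) * (\<Sum>i\<in>UNIV. det (\<chi> j. if j = i then DZ (Yp i) else Yp j))"
    unfolding lie_derivative_def 1 2 by (simp add: sum_subtractf algebra_simps flip: sum_distrib_left)
  also have "\<dots> = (trace (matrix DZ) + Ds z / s (cmap c p)) * (s (cmap c p) * det (\<chi> i. Yp i))"
    unfolding sum_det_rows_linear_map[OF lin] using s0(2) by (simp add: field_simps)
  finally show ?thesis unfolding 3 Ds_def z_def .
qed

text \<open>Evaluating the defining condition on the coordinate fields of the chart, where the volume form has
  the value \<open>\<surd>(det g\<^sub>i\<^sub>j) \<noteq> 0\<close>, shows that at most one number satisfies it.\<close>

lemma divergence_in_chart:
  fixes Z :: "'a \<Rightarrow> ('a, 'n) tvec" and p :: 'a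
  defines "c \<equiv> chart_at A p"
  defines "DZ \<equiv> frechet_derivative (\<lambda>y. Z (cinv c y) c) (at (cmap c p))"
    and "s \<equiv> \<lambda>y. sqrt (det (gram A g c (cinv c y)))"
  assumes Z: "(\<lambda>y. Z (cinv c y) c) differentiable (at (cmap c p))"
  shows "divergence A g Z p =
    trace (matrix DZ) + frechet_derivative s (at (cmap c p)) (Z p c) / s (cmap c p)"
  unfolding divergence_def
proof (rule the_equality, intro allI impI)
  fix U and Y :: "'n \<Rightarrow> 'a \<Rightarrow> ('a, 'n) tvec"
  assume "open U \<and> p \<in> U \<and> (\<forall>i. smooth_vector_field_on A U (Y i))"
  then show "lie_derivative A Z (vol_form A g) Y p =
    (trace (matrix DZ) + frechet_derivative s (at (cmap c p)) (Z p c) / s (cmap c p))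
      * vol_form A g p (\<lambda>i. Y i p)"
    using lie_derivative_vol_form[where Z = Z and p = p and U = U and Y = Y, OF Z[unfolded c_def]]
    unfolding c_def DZ_def s_def by blast
next
  fix d
  assume d: "\<forall>U Y. open U \<and> p \<in> U \<and> (\<forall>i. smooth_vector_field_on A U (Y i)) \<longrightarrow>
    lie_derivative A Z (vol_form A g) Y p = d * vol_form A g p (\<lambda>i. Y i p)"
  have c: "c \<in> A" "p \<in> cdom c" unfolding c_def using chart_at by auto
  have Y: "open (cdom c)" "p \<in> cdom c" "\<And>i. smooth_vector_field_on A (cdom c) (coord_field A c i)"
    using c chart_open coord_field_smooth by auto
  have "lie_derivative A Z (vol_form A g) (coord_field A c) p =
      d * vol_form A g p (\<lambda>i. coord_field A c i p)"
    using d Y by blast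
  moreover have "lie_derivative A Z (vol_form A g) (coord_field A c) p =
    (trace (matrix DZ) + frechet_derivative s (at (cmap c p)) (Z p c) / s (cmap c p))
      * vol_form A g p (\<lambda>i. coord_field A c i p)"
    using lie_derivative_vol_form[where Z = Z and p = p and U = "cdom c" and Y = "coord_field A c", OF Z[unfolded c_def] Y]
    unfolding c_def DZ_def s_def by blast
  moreover have "vol_form A g p (\<lambda>i. coord_field A c i p) \<noteq> 0"
  proof -
    have "(\<chi> i. axis i 1) = (mat 1 :: real ^ 'n ^ 'n)"
      by (simp add: vec_eq_iff axis_def mat_def)
    then show ?thesis
      using vol_form_in_chart[OF c, of "\<lambda>i. coord_field A c i p", OF coord_field_tangent[OF c]]
        gram_det_nonzero[OF c] by (simp add: coord_field_same[OF c])
  qed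
  ultimately show "d =
    trace (matrix DZ) + frechet_derivative s (at (cmap c p)) (Z p c) / s (cmap c p)"
    by simp
qed

lemma differentiable_field_add:
  assumes "differentiable_field Z" "differentiable_field W"
  shows "differentiable_field (\<lambda>x. tvec_add (Z x) (W x))"
  unfolding differentiable_field_def
proof (intro conjI allI ballI)
  fix c p assume c: "c \<in> A" "p \<in> cdom c"
  show "(\<lambda>y. tvec_add (Z (cinv c y)) (W (cinv c y)) c) differentiable (at (cmap c p))"
    unfolding tvec_add_def
    by (rule differentiable_add[OF differentiable_fieldD[OF assms(1) c] differentiable_fieldD[OF assms(2) c]])
qed (intro tangent_space_add differentiable_field_tangent assms)

lemma differentiable_field_scale:
  assumes "differentiable_fun f" "differentiable_field Z"
  shows "differentiable_field (\<lambda>x. tvec_scale (f x) (Z x))"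
  unfolding differentiable_field_def
proof (intro conjI allI ballI)
  fix c p assume c: "c \<in> A" "p \<in> cdom c"
  have "(\<lambda>y. (f \<circ> cinv c) y *\<^sub>R Z (cinv c y) c) differentiable (at (cmap c p))"
  proof (rule differentiable_scaleR)
    show "(\<lambda>y. (f \<circ> cinv c) y) differentiable (at (cmap c p))"
      using differentiable_funD[OF assms(1) c] unfolding differentiable_def by blast
  qed (rule differentiable_fieldD[OF assms(2) c])
  then show "(\<lambda>y. tvec_scale (f (cinv c y)) (Z (cinv c y)) c) differentiable (at (cmap c p))"
    unfolding tvec_scale_def comp_def .
qed (intro tangent_space_scale differentiable_field_tangent assms)

lemma trace_matrix: "trace (matrix L) = (\<Sum>i\<in>UNIV. L (axis i 1) $ i)"
  by (simp add: trace_def matrix_def)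

lemma divergence_add:
  assumes Z: "differentiable_field Z" and W: "differentiable_field W"
  shows "divergence A g (\<lambda>x. tvec_add (Z x) (W x)) p = divergence A g Z p + divergence A g W p"
proof -
  let ?c = "chart_at A p"
  have c: "?c \<in> A" "p \<in> cdom ?c" using chart_at by auto
  note d = differentiable_fieldD[OF Z c] differentiable_fieldD[OF W c]
    differentiable_fieldD[OF differentiable_field_add[OF Z W] c]
  let ?y = "cmap ?c p"
  have "((\<lambda>y. tvec_add (Z (cinv ?c y)) (W (cinv ?c y)) ?c) has_derivative
      (\<lambda>h. frechet_derivative (\<lambda>y. Z (cinv ?c y) ?c) (at ?y) h
        + frechet_derivative (\<lambda>y. W (cinv ?c y) ?c) (at ?y) h)) (at ?y)"
    unfolding tvec_add_def using d(1,2) unfolding frechet_derivative_works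
    by (rule has_derivative_add)
  note D = frechet_derivative_eqI[OF this]
  show ?thesis
    unfolding divergence_in_chart[where Z = Z and p = p, OF d(1)] divergence_in_chart[where Z = W and p = p, OF d(2)]
      divergence_in_chart[where Z = "\<lambda>x. tvec_add (Z x) (W x)" and p = p, OF d(3)] D trace_matrix
    by (simp add: tvec_add_def sum.distrib add_divide_distrib
        linear_add[OF has_derivative_linear[OF volume_density_has_derivative[OF c]]])
qed

text \<open>The trace of \<open>D(f Z) = f DZ + df \<otimes> Z\<close> is \<open>f tr(DZ) + df(Z)\<close>.\<close>

lemma divergence_scale:
  assumes f: "differentiable_fun f" and Z: "differentiable_field Z"
  shows "divergence A g (\<lambda>x. tvec_scale (f x) (Z x)) p =
    f p * divergence A g Z p + differential A f p (Z p)"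
proof -
  let ?c = "chart_at A p"
  have c: "?c \<in> A" "p \<in> cdom ?c" using chart_at by auto
  note d = differentiable_fieldD[OF Z c]
    differentiable_fieldD[OF differentiable_field_scale[OF f Z] c]
  let ?y = "cmap ?c p"
  let ?Df = "frechet_derivative (f \<circ> cinv ?c) (at ?y)"
  let ?DZ = "frechet_derivative (\<lambda>y. Z (cinv ?c y) ?c) (at ?y)"
  have fD: "(f \<circ> cinv ?c has_derivative ?Df) (at ?y)" by (rule differentiable_funD[OF f c])
  have "((\<lambda>y. (f \<circ> cinv ?c) y *\<^sub>R Z (cinv ?c y) ?c) has_derivative
      (\<lambda>h. (f \<circ> cinv ?c) ?y *\<^sub>R ?DZ h + ?Df h *\<^sub>R Z (cinv ?c ?y) ?c)) (at ?y)"
    using fD d(1)[unfolded frechet_derivative_works] by (rule has_derivative_scaleR)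
  then have "((\<lambda>y. tvec_scale (f (cinv ?c y)) (Z (cinv ?c y)) ?c) has_derivative
      (\<lambda>h. f p *\<^sub>R ?DZ h + ?Df h *\<^sub>R Z p ?c)) (at ?y)"
    unfolding tvec_scale_def comp_apply cinv_cmap[OF c] .
  note D = frechet_derivative_eqI[OF this]
  have "?Df (Z p ?c) = (\<Sum>i\<in>UNIV. ?Df (axis i 1) * Z p ?c $ i)"
    by (subst linear_cart_expand[OF has_derivative_linear[OF fD]]) (simp add: mult.commute)
  then have df: "differential A f p (Z p) = (\<Sum>i\<in>UNIV. ?Df (axis i 1) * Z p ?c $ i)"
    unfolding differential_def Let_def .
  show ?thesis
    unfolding divergence_in_chart[where Z = Z and p = p, OF d(1)] df
      divergence_in_chart[where Z = "\<lambda>x. tvec_scale (f x) (Z x)" and p = p, OF d(2)] D trace_matrix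
    by (simp add: tvec_scale_def sum.distrib distrib_left sum_distrib_left
        linear_scale[OF has_derivative_linear[OF volume_density_has_derivative[OF c]]])
qed

lemma laplacian_mult:
  assumes u: "twice_differentiable_fun u" and v: "twice_differentiable_fun v"
  shows "laplacian A g (\<lambda>x. u x * v x) p =
    u p * laplacian A g v p + v p * laplacian A g u p + 2 * g p (grad A g u p) (grad A g v p)"
proof -
  note d = assms[unfolded twice_differentiable_fun_def]
  have "grad A g (\<lambda>x. u x * v x) =
      (\<lambda>x. tvec_add (tvec_scale (u x) (grad A g v x)) (tvec_scale (v x) (grad A g u x)))"
    using d grad_mult by blast
  then have "laplacian A g (\<lambda>x. u x * v x) p =
      (u p * laplacian A g v p + differential A u p (grad A g v p))
      + (v p * laplacian A g u p + differential A v p (grad A g u p))"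
    using d by (simp add: laplacian_def divergence_add divergence_scale differentiable_field_scale)
  moreover have "g p (grad A g u p) (grad A g v p) = differential A u p (grad A g v p)"
    "g p (grad A g v p) (grad A g u p) = differential A v p (grad A g u p)"
    using d by (simp_all add: grad_works)
  moreover have "g p (grad A g u p) (grad A g v p) = g p (grad A g v p) (grad A g u p)"
    using d by (intro metric_sym grad_works(1)) simp_all
  ultimately show ?thesis by simp
qed

lemma twice_differentiable_fun_compose:
  assumes u: "twice_differentiable_fun u"
    and F: "\<And>x. (F has_real_derivative F' (u x)) (at (u x))"
    and F': "\<And>x. (F' has_real_derivative F'' (u x)) (at (u x))"
  shows "twice_differentiable_fun (\<lambda>x. F (u x))"
proof -
  have d: "differentiable_fun u" "differentiable_field (grad A g u)"
    using u by (auto simp: twice_differentiable_fun_def)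
  have "grad A g (\<lambda>x. F (u x)) = (\<lambda>x. tvec_scale (F' (u x)) (grad A g u x))"
    using grad_compose[OF d(1) F] by blast
  then show ?thesis
    unfolding twice_differentiable_fun_def
    using differentiable_fun_compose[OF d(1) F] differentiable_fun_compose[OF d(1) F'] d(2)
    by (simp add: differentiable_field_scale)
qed

lemma laplacian_compose:
  assumes u: "twice_differentiable_fun u"
    and F: "\<And>x. (F has_real_derivative F' (u x)) (at (u x))"
    and F': "\<And>x. (F' has_real_derivative F'' (u x)) (at (u x))"
  shows "laplacian A g (\<lambda>x. F (u x)) p =
    F' (u p) * laplacian A g u p + F'' (u p) * g p (grad A g u p) (grad A g u p)"
proof -
  have d: "differentiable_fun u" "differentiable_field (grad A g u)"
    using u by (auto simp: twice_differentiable_fun_def)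
  have "grad A g (\<lambda>x. F (u x)) = (\<lambda>x. tvec_scale (F' (u x)) (grad A g u x))"
    using grad_compose[OF d(1) F] by blast
  then show ?thesis
    using d differentiable_fun_compose[OF d(1) F']
    by (simp add: laplacian_def divergence_scale differential_compose[OF d(1) F'] grad_works)
qed


section \<open>Functions in polar form\<close>

text \<open>The real and imaginary parts are \<open>u cos \<theta>\<close> and \<open>- u sin \<theta>\<close>; the product and chain rules for real
  functions apply to each of them.\<close>

lemma cgrad_polar:
  assumes u: "differentiable_fun u" and \<theta>: "differentiable_fun \<theta>" and v: "v \<in> tangent_space A p"
  shows "cmetric g p v (cgrad A g (\<lambda>x. complex_of_real (u x) * cis (- \<theta> x)) p) =
    cis (- \<theta> p) * Complex (g p v (grad A g u p)) (- u p * g p v (grad A g \<theta> p))"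
proof -
  have c: "differentiable_fun (\<lambda>x. cos (\<theta> x))"
    by (rule differentiable_fun_compose[OF \<theta>]) (rule DERIV_cos)
  have s: "differentiable_fun (\<lambda>x. - sin (\<theta> x))"
    by (rule differentiable_fun_compose[OF \<theta>, where F = "\<lambda>r. - sin r"])
      (rule DERIV_minus[OF DERIV_sin])
  have gc: "grad A g (\<lambda>x. cos (\<theta> x)) p = tvec_scale (- sin (\<theta> p)) (grad A g \<theta> p)"
    by (rule grad_compose[OF \<theta> DERIV_cos])
  have gs: "grad A g (\<lambda>x. - sin (\<theta> x)) p = tvec_scale (- cos (\<theta> p)) (grad A g \<theta> p)"
    by (rule grad_compose[OF \<theta> DERIV_minus[OF DERIV_sin]])
  have re: "Re (complex_of_real (u x) * cis (- \<theta> x)) = u x * cos (\<theta> x)"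
    and im: "Im (complex_of_real (u x) * cis (- \<theta> x)) = u x * (- sin (\<theta> x))" for x
    by simp_all
  show ?thesis
    unfolding cgrad_def cmetric_def re im fst_conv snd_conv grad_mult[OF u c] grad_mult[OF u s] gc gs
    using v grad_works(1)[OF u, of p] grad_works(1)[OF \<theta>, of p]
    by (simp add: complex_eq_iff metric_simps algebra_simps)
qed

lemma claplacian_polar:
  assumes u: "twice_differentiable_fun u" and \<theta>: "twice_differentiable_fun \<theta>"
  shows "claplacian A g (\<lambda>x. complex_of_real (u x) * cis (- \<theta> x)) p =
    cis (- \<theta> p) * Complex
      (laplacian A g u p - u p * g p (grad A g \<theta> p) (grad A g \<theta> p))
      (- 2 * g p (grad A g u p) (grad A g \<theta> p) - u p * laplacian A g \<theta> p)"
proof -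
  have d: "differentiable_fun u" "differentiable_fun \<theta>"
    using assms unfolding twice_differentiable_fun_def by auto
  have Ds: "((\<lambda>r. - sin r) has_real_derivative - cos r) (at r)"
    "((\<lambda>r. - cos r) has_real_derivative sin r) (at r)" for r :: real
    by (auto intro!: derivative_eq_intros)
  have c: "twice_differentiable_fun (\<lambda>x. cos (\<theta> x))"
    by (rule twice_differentiable_fun_compose[OF \<theta> DERIV_cos Ds(1)])
  have s: "twice_differentiable_fun (\<lambda>x. - sin (\<theta> x))"
    by (rule twice_differentiable_fun_compose[OF \<theta> Ds])
  have gc: "grad A g (\<lambda>x. cos (\<theta> x)) p = tvec_scale (- sin (\<theta> p)) (grad A g \<theta> p)"
    by (rule grad_compose[OF d(2) DERIV_cos])
  have gs: "grad A g (\<lambda>x. - sin (\<theta> x)) p = tvec_scale (- cos (\<theta> p)) (grad A g \<theta> p)"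
    by (rule grad_compose[OF d(2) Ds(1)])
  have lc: "laplacian A g (\<lambda>x. cos (\<theta> x)) p = - sin (\<theta> p) * laplacian A g \<theta> p
      + - cos (\<theta> p) * g p (grad A g \<theta> p) (grad A g \<theta> p)"
    by (rule laplacian_compose[OF \<theta> DERIV_cos Ds(1)])
  have ls: "laplacian A g (\<lambda>x. - sin (\<theta> x)) p = - cos (\<theta> p) * laplacian A g \<theta> p
      + sin (\<theta> p) * g p (grad A g \<theta> p) (grad A g \<theta> p)"
    by (rule laplacian_compose[OF \<theta> Ds])
  have re: "Re (complex_of_real (u x) * cis (- \<theta> x)) = u x * cos (\<theta> x)"
    and im: "Im (complex_of_real (u x) * cis (- \<theta> x)) = u x * (- sin (\<theta> x))" for x
    by simp_all
  have "claplacian A g (\<lambda>x. complex_of_real (u x) * cis (- \<theta> x)) p =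
      Complex (laplacian A g (\<lambda>x. u x * cos (\<theta> x)) p) (laplacian A g (\<lambda>x. u x * (- sin (\<theta> x))) p)"
    unfolding claplacian_def cdivergence_def cgrad_def laplacian_def re im fst_conv snd_conv
    by (rule refl)
  then show ?thesis
    unfolding laplacian_mult[OF u c] laplacian_mult[OF u s] gc gs lc ls
    using grad_works(1)[OF d(1), of p] grad_works(1)[OF d(2), of p]
    by (simp add: complex_eq_iff metric_simps algebra_simps)
qed


section \<open>The equations at a fixed time\<close>

lemma smooth_fun_family_slice:
  assumes "smooth_fun_family A I f" "open I" "t \<in> I"
  shows "smooth_fun A (f t)"
  unfolding smooth_fun_def
proof
  fix c assume c: "c \<in> A"
  have "smooth_on (I \<times> cmap c ` cdom c) (\<lambda>(s, y). f s (cinv c y))"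
    using assms(1) c unfolding smooth_fun_family_def by blast
  from smooth_on_slice[OF this assms(2) chart_image_open[OF c] assms(3)]
  show "smooth_on (cmap c ` cdom c) (f t \<circ> cinv c)" by (simp add: comp_def)
qed

lemma smooth_fun_family_time_deriv:
  fixes f :: "real \<Rightarrow> 'a \<Rightarrow> real"
  assumes "smooth_fun_family A I f" "t \<in> I"
  shows "((\<lambda>s. f s x) has_real_derivative time_deriv f t x) (at t)"
proof -
  let ?c = "chart_at A x"
  have c: "?c \<in> A" "x \<in> cdom ?c" using chart_at by auto
  have "smooth_on (I \<times> cmap ?c ` cdom ?c) (\<lambda>(s, y). f s (cinv ?c y))"
    using assms(1) c unfolding smooth_fun_family_def by blast
  then have "(\<lambda>(s, y). f s (cinv ?c y)) differentiable (at (t, cmap ?c x))"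
    by (rule smooth_on_differentiable) (use c assms in blast)
  moreover have "(\<lambda>s. (s, cmap ?c x)) differentiable (at t)"
    unfolding differentiable_def by (auto intro!: exI derivative_eq_intros)
  ultimately have "(\<lambda>s. (\<lambda>(s, y). f s (cinv ?c y)) (s, cmap ?c x)) differentiable (at t)"
    by (rule differentiable_compose)
  then have "(\<lambda>s. f s x) differentiable (at t)"
    unfolding case_prod_conv cinv_cmap[OF c] .
  then show ?thesis
    unfolding time_deriv_def has_real_derivative_iff_has_vector_derivative vector_derivative_works .
qed

lemma smooth_vector_field_family_slice:
  assumes "smooth_vector_field_family A I X" "open I" "t \<in> I"
  shows "differentiable_field (X t)"
  unfolding differentiable_field_def
proof (intro conjI allI ballI)
  show "X t p \<in> tangent_space A p" for p
    using assms unfolding smooth_vector_field_family_def by blast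
  fix c p assume c: "c \<in> A" "p \<in> cdom c"
  have "smooth_on (I \<times> cmap c ` cdom c) (\<lambda>(s, y). X s (cinv c y) c)"
    using assms(1) c unfolding smooth_vector_field_family_def by blast
  from smooth_on_slice[OF this assms(2) chart_image_open[OF c(1)] assms(3)]
  have "smooth_on (cmap c ` cdom c) (\<lambda>y. X t (cinv c y) c)" by simp
  then show "(\<lambda>y. X t (cinv c y) c) differentiable (at (cmap c p))"
    by (rule smooth_on_differentiable) (use c in blast)
qed

text \<open>If \<open>\<rho> = R\<^sup>2\<close>, then \<open>\<partial>\<^sub>t\<rho> = 2 R \<partial>\<^sub>tR\<close>; the same factor is taken out of \<open>div(\<rho> (\<nabla>\<phi> + X))\<close>, so that
  the remaining one is the value of \<open>\<partial>\<^sub>tR\<close>.\<close>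

lemma velocity_square:
  assumes R: "differentiable_fun R" and \<phi>: "twice_differentiable_fun \<phi>" and X: "differentiable_field X"
  shows "velocity A g X (\<lambda>x. R x * R x) \<phi> p = 2 * R p *
    (g p (grad A g R p) (grad A g \<phi> p) + g p (grad A g R p) (X p)
      + R p / 2 * (laplacian A g \<phi> p + divergence A g X p))"
proof -
  have \<phi>': "differentiable_field (grad A g \<phi>)"
    using \<phi> unfolding twice_differentiable_fun_def by blast
  have T: "grad A g \<phi> p \<in> tangent_space A p" "X p \<in> tangent_space A p"
    using \<phi>' X by (auto intro: differentiable_field_tangent)
  have "velocity A g X (\<lambda>x. R x * R x) \<phi> p =
      R p * R p * (laplacian A g \<phi> p + divergence A g X p)
      + differential A (\<lambda>x. R x * R x) p (tvec_add (grad A g \<phi> p) (X p))"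
    unfolding velocity_def laplacian_def
      divergence_scale[OF differentiable_fun_mult[OF R R] differentiable_field_add[OF \<phi>' X]]
      divergence_add[OF \<phi>' X] by (rule refl)
  also have "differential A (\<lambda>x. R x * R x) p (tvec_add (grad A g \<phi> p) (X p)) =
      2 * R p * (g p (grad A g R p) (grad A g \<phi> p) + g p (grad A g R p) (X p))"
    using T grad_works(1)[OF R, of p] grad_works(2)[OF R tangent_space_add[OF T], symmetric]
    by (simp add: differential_mult[OF R R] metric_simps)
  finally show ?thesis by (simp add: algebra_simps)
qed

end

lemma wave_function_polar:
  "wave_function hbar \<rho> \<phi> C t x =
    complex_of_real (sqrt (\<rho> t x)) * cis (- ((\<phi> t x - C t) / hbar))"
  by (simp add: wave_function_def cis_conv_exp)

lemma has_vector_derivative_polar: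
  assumes "(u has_real_derivative u') (at t)" "(\<theta> has_real_derivative \<theta>') (at t)"
  shows "((\<lambda>s. complex_of_real (u s) * cis (- \<theta> s)) has_vector_derivative
    cis (- \<theta> t) * Complex u' (- u t * \<theta>')) (at t)"
  using assms unfolding has_vector_derivative_complex_iff
  by (auto intro!: derivative_eq_intros simp: algebra_simps)

theorem corollary3p5:
  fixes A :: "('a::t2_space, 'n::finite) chart set"
    and g :: "'a \<Rightarrow> ('a, 'n) tvec \<Rightarrow> ('a, 'n) tvec \<Rightarrow> real"
    and X :: "real \<Rightarrow> 'a \<Rightarrow> ('a, 'n) tvec"
    and V :: "real \<Rightarrow> 'a \<Rightarrow> real"
    and hbar :: real
    and I :: "real set"
    and \<rho> \<phi> :: "real \<Rightarrow> 'a \<Rightarrow> real"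
    and c C :: "real \<Rightarrow> real"
    and \<psi> :: "real \<Rightarrow> 'a \<Rightarrow> complex"
  assumes "compact_connected_oriented_riemannian_manifold A g"
    and "smooth_vector_field_family A UNIV X"
    and "smooth_fun_family A UNIV V"
    and "hbar > 0"
    and "open I" and "is_interval I"
    and "smooth_density_curve A g I \<rho>"
    and "euler_lagrange A g X V hbar I \<rho>"
    and "smooth_fun_family A I \<phi>"
    and "\<And>t x. t \<in> I \<Longrightarrow> time_deriv \<rho> t x = velocity A g (X t) (\<rho> t) (\<phi> t) x"
    and "\<And>t x. t \<in> I \<Longrightarrow> time_deriv \<phi> t x =
           1/2 * g x (tvec_add (grad A g (\<phi> t) x) (X t x)) (tvec_add (grad A g (\<phi> t) x) (X t x))
           + V t x
           - hbar\<^sup>2 / 2 * (laplacian A g (\<lambda>y. sqrt (\<rho> t y)) x / sqrt (\<rho> t x))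
           + c t"
    and "\<And>t. t \<in> I \<Longrightarrow> (C has_real_derivative c t) (at t)"
    and "\<psi> = wave_function hbar \<rho> \<phi> C"
  shows "\<forall>t\<in>I. \<forall>x.
           (\<lambda>s. \<psi> s x) differentiable (at t) \<and>
           \<i> * complex_of_real hbar * time_deriv \<psi> t x =
             - (complex_of_real hbar)\<^sup>2 / 2 * claplacian A g (\<psi> t) x
             - complex_of_real hbar / \<i> * cmetric g x (X t x) (cgrad A g (\<psi> t) x)
             + 1/2 * (- (complex_of_real hbar / \<i>) * complex_of_real (divergence A g (X t) x)
                      + complex_of_real (g x (X t x) (X t x))) * \<psi> t x
             + complex_of_real (V t x) * \<psi> t x"
proof (intro ballI allI)
  fix t x assume t: "t \<in> I"
  interpret oriented_riemannian A g
    using assms(1) unfolding compact_connected_oriented_riemannian_manifold_def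
    by unfold_locales blast+
  have \<rho>: "smooth_fun_family A I \<rho>" "smooth_fun A (\<rho> t)" and \<rho>_pos: "\<rho> t y > 0" for y
    using assms(7) t unfolding smooth_density_curve_def densities_def by auto
  define R where "R = (\<lambda>y. sqrt (\<rho> t y))"
  define \<theta> where "\<theta> = (\<lambda>y. (\<phi> t y - C t) / hbar)"
  have R_pos: "R y > 0" for y using \<rho>_pos by (simp add: R_def)

  have X: "differentiable_field (X t)"
    by (rule smooth_vector_field_family_slice[OF assms(2) open_UNIV UNIV_I])
  have \<phi>: "twice_differentiable_fun (\<phi> t)"
    by (rule smooth_imp_twice_differentiable[OF smooth_fun_family_slice[OF assms(9,5) t]])
  have R: "twice_differentiable_fun R"
  proof -
    have 1: "(sqrt has_real_derivative inverse (sqrt (\<rho> t y)) / 2) (at (\<rho> t y))" for y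
      by (rule DERIV_real_sqrt[OF \<rho>_pos])
    have 2: "((\<lambda>r. inverse (sqrt r) / 2) has_real_derivative
        (\<lambda>r. - (inverse (sqrt r) / 2 * inverse (sqrt r) * inverse (sqrt r)) / 2) (\<rho> t y))
        (at (\<rho> t y))" for y
      using \<rho>_pos[of y]
      by (auto intro!: derivative_eq_intros simp: field_simps power2_eq_square)
    show ?thesis unfolding R_def
      by (rule twice_differentiable_fun_compose[OF smooth_imp_twice_differentiable[OF \<rho>(2)] 1 2])
  qed
  have D: "((\<lambda>r. (r - C t) / hbar) has_real_derivative 1 / hbar) (at r)"
    "((\<lambda>r. 1 / hbar) has_real_derivative 0) (at r)" for r
    using assms(4) by (auto intro!: derivative_eq_intros)
  have \<theta>: "twice_differentiable_fun \<theta>" unfolding \<theta>_def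
    by (rule twice_differentiable_fun_compose[OF \<phi> D])
  have d: "differentiable_fun R" "differentiable_fun (\<phi> t)" "differentiable_fun \<theta>"
    using R \<phi> \<theta> unfolding twice_differentiable_fun_def by auto
  have grad_\<theta>: "grad A g \<theta> x = tvec_scale (1 / hbar) (grad A g (\<phi> t) x)"
    unfolding \<theta>_def by (rule grad_compose[OF d(2) D(1)])
  have lap_\<theta>: "laplacian A g \<theta> x = 1 / hbar * laplacian A g (\<phi> t) x"
    unfolding \<theta>_def using laplacian_compose[OF \<phi> D, of x] by simp

  define GR G\<phi> W where "GR = grad A g R x" and "G\<phi> = grad A g (\<phi> t) x" and "W = X t x"
  have T: "GR \<in> tangent_space A x" "G\<phi> \<in> tangent_space A x" "W \<in> tangent_space A x"
    unfolding GR_def G\<phi>_def W_def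
    using d X by (auto intro: grad_works(1) differentiable_field_tangent)
  \<comment> \<open>the value of \<open>\<partial>\<^sub>tR\<close> that the continuity equation prescribes\<close>
  define R' where "R' = g x GR G\<phi> + g x GR W
      + R x / 2 * (laplacian A g (\<phi> t) x + divergence A g (X t) x)"
  have "(\<lambda>y. R y * R y) = \<rho> t"
    using \<rho>_pos by (simp add: R_def less_imp_le)
  then have \<rho>_t: "time_deriv \<rho> t x = 2 * R x * R'"
    using assms(10)[OF t, of x] velocity_square[OF d(1) \<phi> X, of x]
    unfolding R'_def GR_def G\<phi>_def W_def by simp
  have R_t: "((\<lambda>s. sqrt (\<rho> s x)) has_real_derivative R') (at t)"
    using smooth_fun_family_time_deriv[OF \<rho>(1) t, of x] \<rho>_t \<rho>_pos[of x] R_pos[of x]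
    by (auto intro!: derivative_eq_intros simp: R_def field_simps)
  define \<theta>' where "\<theta>' = (time_deriv \<phi> t x - c t) / hbar"
  have \<theta>_t: "((\<lambda>s. (\<phi> s x - C s) / hbar) has_real_derivative \<theta>') (at t)"
    unfolding \<theta>'_def using smooth_fun_family_time_deriv[OF assms(9) t, of x] assms(12)[OF t] assms(4)
    by (auto intro!: derivative_eq_intros)
  have \<theta>'_eq: "hbar * R x * \<theta>' = R x * (1/2 * g x G\<phi> G\<phi> + g x W G\<phi> + 1/2 * g x W W + V t x)
      - hbar\<^sup>2 / 2 * laplacian A g R x"
  proof -
    have "hbar * \<theta>' = time_deriv \<phi> t x - c t" using assms(4) by (simp add: \<theta>'_def)
    also have "\<dots> = 1/2 * g x (tvec_add G\<phi> W) (tvec_add G\<phi> W) + V t x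
        - hbar\<^sup>2 / 2 * (laplacian A g R x / R x)"
      using assms(11)[OF t, of x] by (simp add: R_def G\<phi>_def W_def)
    also have "g x (tvec_add G\<phi> W) (tvec_add G\<phi> W) = g x G\<phi> G\<phi> + 2 * g x W G\<phi> + g x W W"
      using T metric_sym[OF T(2,3)] by (simp add: metric_simps)
    finally have *: "hbar * \<theta>' = 1/2 * (g x G\<phi> G\<phi> + 2 * g x W G\<phi> + g x W W) + V t x
        - hbar\<^sup>2 / 2 * (laplacian A g R x / R x)" .
    have **: "laplacian A g R x = R x * (laplacian A g R x / R x)" using R_pos[of x] by simp
    have "hbar * R x * \<theta>' = R x * (hbar * \<theta>')" by simp
    also have "\<dots> = R x * (1/2 * g x G\<phi> G\<phi> + g x W G\<phi> + 1/2 * g x W W + V t x)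
        - hbar\<^sup>2 / 2 * (R x * (laplacian A g R x / R x))"
      unfolding * by (simp add: algebra_simps)
    finally show ?thesis unfolding **[symmetric] .
  qed

  let ?E = "cis (- \<theta> x)"
  have \<psi>: "\<psi> s y = complex_of_real (sqrt (\<rho> s y)) * cis (- ((\<phi> s y - C s) / hbar))" for s y
    unfolding assms(13) by (rule wave_function_polar)
  have \<psi>t: "\<psi> t = (\<lambda>y. complex_of_real (R y) * cis (- \<theta> y))"
    unfolding R_def \<theta>_def by (rule ext) (rule \<psi>)
  have der: "((\<lambda>s. \<psi> s x) has_vector_derivative ?E * Complex R' (- R x * \<theta>')) (at t)"
    unfolding \<psi> R_def \<theta>_def by (rule has_vector_derivative_polar[OF R_t \<theta>_t])
  then have time: "time_deriv \<psi> t x = ?E * Complex R' (- R x * \<theta>')"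
    unfolding time_deriv_def by (rule vector_derivative_at)
  have lap: "claplacian A g (\<psi> t) x = ?E * Complex
      (laplacian A g R x - R x * (1 / hbar\<^sup>2 * g x G\<phi> G\<phi>))
      (- 2 / hbar * g x GR G\<phi> - R x / hbar * laplacian A g (\<phi> t) x)"
    using T unfolding \<psi>t claplacian_polar[OF R \<theta>] grad_\<theta> lap_\<theta> GR_def G\<phi>_def
    by (simp add: metric_simps power2_eq_square)
  have grad: "cmetric g x (X t x) (cgrad A g (\<psi> t) x) =
      ?E * Complex (g x GR W) (- R x / hbar * g x W G\<phi>)"
    using T metric_sym[OF T(1,3)] unfolding \<psi>t W_def cgrad_polar[OF d(1,3) T(3)[unfolded W_def]] grad_\<theta> GR_def G\<phi>_def
    by (simp add: metric_simps)
  \<comment> \<open>the Schroedinger equation without the common factor \<open>e\<^sup>-\<^sup>i\<^sup>\<theta>\<close>\<close>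
  have "\<i> * complex_of_real hbar * Complex R' (- R x * \<theta>') =
      - (complex_of_real hbar)\<^sup>2 / 2 * Complex
        (laplacian A g R x - R x * (1 / hbar\<^sup>2 * g x G\<phi> G\<phi>))
        (- 2 / hbar * g x GR G\<phi> - R x / hbar * laplacian A g (\<phi> t) x)
      - complex_of_real hbar / \<i> * Complex (g x GR W) (- R x / hbar * g x W G\<phi>)
      + 1/2 * (- (complex_of_real hbar / \<i>) * complex_of_real (divergence A g (X t) x)
          + complex_of_real (g x W W)) * complex_of_real (R x)
      + complex_of_real (V t x) * complex_of_real (R x)" (is "?l = ?r")
  proof (rule complex_eqI)
    have sq: "(complex_of_real hbar)\<^sup>2 = complex_of_real (hbar\<^sup>2)" by simp
    have i: "complex_of_real hbar / \<i> = - \<i> * complex_of_real hbar" by (simp add: divide_complex_def)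
    show "Re ?l = Re ?r"
    proof -
      have "Re ?r = R x * (1/2 * g x G\<phi> G\<phi> + g x W G\<phi> + 1/2 * g x W W + V t x)
          - hbar\<^sup>2 / 2 * laplacian A g R x"
        using assms(4) unfolding sq i by (simp add: field_simps)
      moreover have "Re ?l = hbar * R x * \<theta>'" by simp
      ultimately show ?thesis using \<theta>'_eq by (simp only:)
    qed
    show "Im ?l = Im ?r"
      using assms(4) unfolding sq i R'_def by (simp add: field_simps power2_eq_square)
  qed
  from arg_cong[OF this, of "\<lambda>z. ?E * z"]
  have "\<i> * complex_of_real hbar * time_deriv \<psi> t x =
             - (complex_of_real hbar)\<^sup>2 / 2 * claplacian A g (\<psi> t) x
             - complex_of_real hbar / \<i> * cmetric g x (X t x) (cgrad A g (\<psi> t) x)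
             + 1/2 * (- (complex_of_real hbar / \<i>) * complex_of_real (divergence A g (X t) x)
                      + complex_of_real (g x (X t x) (X t x))) * \<psi> t x
             + complex_of_real (V t x) * \<psi> t x"
    unfolding time lap grad by (simp add: \<psi>t W_def algebra_simps)
  moreover have "(\<lambda>s. \<psi> s x) differentiable (at t)"
    using der by (rule differentiableI_vector)
  ultimately show "(\<lambda>s. \<psi> s x) differentiable (at t) \<and>
           \<i> * complex_of_real hbar * time_deriv \<psi> t x =
             - (complex_of_real hbar)\<^sup>2 / 2 * claplacian A g (\<psi> t) x
             - complex_of_real hbar / \<i> * cmetric g x (X t x) (cgrad A g (\<psi> t) x)
             + 1/2 * (- (complex_of_real hbar / \<i>) * complex_of_real (divergence A g (X t) x)
                      + complex_of_real (g x (X t x) (X t x))) * \<psi> t x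
             + complex_of_real (V t x) * \<psi> t x"
    by blast
qed

end
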